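(* Let $(M,g)$ be a compact pseudo-Kähler $\partial\overline{\partial}$ manifold, with complex structure $J$. Then every Killing vector field $v$ of $(M,g)$ is real holomorphic, that is, $\mathcal{L}_v J=0$.
   Context: All manifolds, mappings, tensor fields and connections are assumed smooth. A pseudo-Kähler manifold is a pseudo-Riemannian manifold $(M,g)$ (with $g$ of any signature) endowed with an almost-complex structure $J$ which is parallel, $\nabla J=0$, for the Levi-Civita connection $\nabla$ of $g$, and such that at every point $x\in M$ the operator $J_x:T_xM\to T_xM$ is a linear $g_x$-isometry (equivalently, is $g_x$-skew-adjoint). These conditions imply that $J$ is integrable, so $M$ is a complex manifold. A pseudo-Kähler $\partial\overline{\partial}$ manifold is a pseudo-Kähler manifold $(M,g)$ whose underlying complex manifold $M$ has the $\partial\overline{\partial}$ property: every closed (i.e. $d$-closed) complex-valued differential $(p,q)$ form on $M$ that is $\partial$-exact or $\overline{\partial}$-exact equals $\partial\overline{\partial}\lambda$ for some $(p-1,q-1)$ form $\lambda$ (when $p=0$ or $q=0$, the only $(p-1,q-1)$ form is $0$). A Killing vector field is a vector field $v$ with $\mathcal{L}_v g=0$, where $\mathcal{L}_v$ is the Lie derivative. A vector field $v$ is called real holomorphic if $\mathcal{L}_vJ=0$. *)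

theory Defs
  imports "HOL-Analysis.Analysis"
begin

section \<open>Smooth manifolds\<close>

text \<open>The sets on which the next two predicates are used are open.\<close>

primrec Ck_on :: "nat \<Rightarrow> ('a::real_normed_vector \<Rightarrow> 'b::real_normed_vector) \<Rightarrow> 'a set \<Rightarrow> bool" where
  "Ck_on 0 f S = continuous_on S f"
| "Ck_on (Suc k) f S =
    ((\<forall>x\<in>S. f differentiable (at x)) \<and> (\<forall>v. Ck_on k (\<lambda>x. frechet_derivative f (at x) v) S))"

definition smooth_on :: "('a::real_normed_vector \<Rightarrow> 'b::real_normed_vector) \<Rightarrow> 'a set \<Rightarrow> bool" where
  "smooth_on f S \<longleftrightarrow> (\<forall>k. Ck_on k f S)"

text \<open>A chart is a pair of its domain and its coordinate map; only the values of the coordinate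
  map on the domain matter. The atlas need not be maximal.\<close>

record ('a, 'e) manifold =
  mtop :: "'a topology"
  atlas :: "('a set \<times> ('a \<Rightarrow> 'e)) set"

abbreviation pts :: "('a, 'e, 'z) manifold_scheme \<Rightarrow> 'a set" where
  "pts S \<equiv> topspace (mtop S)"

definition is_chart :: "'a topology \<Rightarrow> 'a set \<times> ('a \<Rightarrow> 'e::euclidean_space) \<Rightarrow> bool" where
  "is_chart X c \<longleftrightarrow> (case c of (U, \<phi>) \<Rightarrow>
     openin X U \<and> open (\<phi> ` U) \<and> homeomorphic_map (subtopology X U) (top_of_set (\<phi> ` U)) \<phi>)"

definition smooth_manifold :: "('a, 'e::euclidean_space) manifold \<Rightarrow> bool" where
  "smooth_manifold S \<longleftrightarrow>
     Hausdorff_space (mtop S) \<and> second_countable (mtop S) \<and>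
     (\<forall>c\<in>atlas S. is_chart (mtop S) c) \<and>
     (\<Union>c\<in>atlas S. fst c) = pts S \<and>
     (\<forall>(U, \<phi>)\<in>atlas S. \<forall>(V, \<psi>)\<in>atlas S. smooth_on (\<psi> \<circ> inv_into U \<phi>) (\<phi> ` (U \<inter> V)))"

definition smooth_fun :: "('a, 'e::euclidean_space) manifold \<Rightarrow> ('a \<Rightarrow> 'b::real_normed_vector) \<Rightarrow> bool" where
  "smooth_fun S f \<longleftrightarrow> (\<forall>(U, \<phi>)\<in>atlas S. smooth_on (f \<circ> inv_into U \<phi>) (\<phi> ` U))"


section \<open>Tangent vectors and vector fields\<close>

text \<open>Tangent vectors at a point are the derivations at that point of the algebra of globally
  defined smooth real functions. They are set to zero on non-smooth functions, so that equality of
  tangent vectors is equality in HOL. In everything below, values at arguments outside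
  \<^term>\<open>topspace (mtop S)\<close> are irrelevant.\<close>

type_synonym 'a tvec = "('a \<Rightarrow> real) \<Rightarrow> real"

type_synonym 'a vfield = "'a \<Rightarrow> 'a tvec"

definition tv_comb :: "real \<Rightarrow> 'a tvec \<Rightarrow> real \<Rightarrow> 'a tvec \<Rightarrow> 'a tvec" where
  "tv_comb a u b w = (\<lambda>f. a * u f + b * w f)"

definition tv_zero :: "'a tvec" where
  "tv_zero = (\<lambda>f. 0)"

definition tv_minus :: "'a tvec \<Rightarrow> 'a tvec" where
  "tv_minus u = (\<lambda>f. - u f)"

definition tangent_space :: "('a, 'e::euclidean_space) manifold \<Rightarrow> 'a \<Rightarrow> 'a tvec set" where
  "tangent_space S x = {u.
     (\<forall>f. \<not> smooth_fun S f \<longrightarrow> u f = 0) \<and>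
     (\<forall>f h a b. smooth_fun S f \<longrightarrow> smooth_fun S h \<longrightarrow>
        u (\<lambda>y. a * f y + b * h y) = a * u f + b * u h) \<and>
     (\<forall>f h. smooth_fun S f \<longrightarrow> smooth_fun S h \<longrightarrow>
        u (\<lambda>y. f y * h y) = u f * h x + f x * u h)}"

definition vector_fields :: "('a, 'e::euclidean_space) manifold \<Rightarrow> 'a vfield set" where
  "vector_fields S = {X. (\<forall>x\<in>pts S. X x \<in> tangent_space S x) \<and>
     (\<forall>f. smooth_fun S f \<longrightarrow> smooth_fun S (\<lambda>x. X x f))}"

definition lie_bracket ::
  "('a, 'e::euclidean_space) manifold \<Rightarrow> 'a vfield \<Rightarrow> 'a vfield \<Rightarrow> 'a vfield" where
  "lie_bracket S X Y = (\<lambda>x f. if smooth_fun S f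
     then X x (\<lambda>y. Y y f) - Y x (\<lambda>y. X y f) else 0)"


section \<open>Pseudo-Kaehler manifolds\<close>

type_synonym 'a metric = "'a \<Rightarrow> 'a tvec \<Rightarrow> 'a tvec \<Rightarrow> real"

type_synonym 'a endo = "'a \<Rightarrow> 'a tvec \<Rightarrow> 'a tvec"

definition pseudo_riemannian_metric ::
  "('a, 'e::euclidean_space) manifold \<Rightarrow> 'a metric \<Rightarrow> bool" where
  "pseudo_riemannian_metric S g \<longleftrightarrow>
     (\<forall>x\<in>pts S. \<forall>u\<in>tangent_space S x. \<forall>w\<in>tangent_space S x. \<forall>z\<in>tangent_space S x. \<forall>a b.
        g x (tv_comb a u b w) z = a * g x u z + b * g x w z) \<and>
     (\<forall>x\<in>pts S. \<forall>u\<in>tangent_space S x. \<forall>w\<in>tangent_space S x. g x u w = g x w u) \<and>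
     (\<forall>x\<in>pts S. \<forall>u\<in>tangent_space S x.
        (\<forall>w\<in>tangent_space S x. g x u w = 0) \<longrightarrow> u = tv_zero) \<and>
     (\<forall>X\<in>vector_fields S. \<forall>Y\<in>vector_fields S. smooth_fun S (\<lambda>x. g x (X x) (Y x)))"

definition almost_complex_structure ::
  "('a, 'e::euclidean_space) manifold \<Rightarrow> 'a endo \<Rightarrow> bool" where
  "almost_complex_structure S J \<longleftrightarrow>
     (\<forall>x\<in>pts S. \<forall>u\<in>tangent_space S x. J x u \<in> tangent_space S x \<and> J x (J x u) = tv_minus u) \<and>
     (\<forall>x\<in>pts S. \<forall>u\<in>tangent_space S x. \<forall>w\<in>tangent_space S x. \<forall>a b.
        J x (tv_comb a u b w) = tv_comb a (J x u) b (J x w)) \<and>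
     (\<forall>X\<in>vector_fields S. (\<lambda>x. J x (X x)) \<in> vector_fields S)"

text \<open>In \<open>D x u Y\<close>, the covariant derivative of the vector field \<open>Y\<close> along the tangent
  vector \<open>u\<close> at \<open>x\<close>.\<close>

type_synonym 'a conn = "'a \<Rightarrow> 'a tvec \<Rightarrow> 'a vfield \<Rightarrow> 'a tvec"

definition affine_connection ::
  "('a, 'e::euclidean_space) manifold \<Rightarrow> 'a conn \<Rightarrow> bool" where
  "affine_connection S D \<longleftrightarrow>
     (\<forall>x\<in>pts S. \<forall>u\<in>tangent_space S x. \<forall>Y\<in>vector_fields S. D x u Y \<in> tangent_space S x) \<and>
     (\<forall>x\<in>pts S. \<forall>u\<in>tangent_space S x. \<forall>w\<in>tangent_space S x. \<forall>Y\<in>vector_fields S. \<forall>a b.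
        D x (tv_comb a u b w) Y = tv_comb a (D x u Y) b (D x w Y)) \<and>
     (\<forall>x\<in>pts S. \<forall>u\<in>tangent_space S x. \<forall>Y\<in>vector_fields S. \<forall>Z\<in>vector_fields S.
        D x u (\<lambda>y. tv_comb 1 (Y y) 1 (Z y)) = tv_comb 1 (D x u Y) 1 (D x u Z)) \<and>
     (\<forall>x\<in>pts S. \<forall>u\<in>tangent_space S x. \<forall>Y\<in>vector_fields S. \<forall>f. smooth_fun S f \<longrightarrow>
        D x u (\<lambda>y h. f y * Y y h) = tv_comb (u f) (Y x) (f x) (D x u Y)) \<and>
     (\<forall>X\<in>vector_fields S. \<forall>Y\<in>vector_fields S. (\<lambda>x. D x (X x) Y) \<in> vector_fields S)"

definition levi_civita ::
  "('a, 'e::euclidean_space) manifold \<Rightarrow> 'a metric \<Rightarrow> 'a conn \<Rightarrow> bool" where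
  "levi_civita S g D \<longleftrightarrow>
     affine_connection S D \<and>
     (\<forall>X\<in>vector_fields S. \<forall>Y\<in>vector_fields S. \<forall>x\<in>pts S.
        tv_comb 1 (D x (X x) Y) (-1) (D x (Y x) X) = lie_bracket S X Y x) \<and>
     (\<forall>x\<in>pts S. \<forall>u\<in>tangent_space S x. \<forall>Y\<in>vector_fields S. \<forall>Z\<in>vector_fields S.
        u (\<lambda>y. g y (Y y) (Z y)) = g x (D x u Y) (Z x) + g x (Y x) (D x u Z))"

definition parallel_endo ::
  "('a, 'e::euclidean_space) manifold \<Rightarrow> 'a conn \<Rightarrow> 'a endo \<Rightarrow> bool" where
  "parallel_endo S D J \<longleftrightarrow>
     (\<forall>x\<in>pts S. \<forall>u\<in>tangent_space S x. \<forall>Y\<in>vector_fields S.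
        D x u (\<lambda>y. J y (Y y)) = J x (D x u Y))"

definition pseudo_kaehler ::
  "('a, 'e::euclidean_space) manifold \<Rightarrow> 'a metric \<Rightarrow> 'a endo \<Rightarrow> bool" where
  "pseudo_kaehler S g J \<longleftrightarrow>
     smooth_manifold S \<and> pseudo_riemannian_metric S g \<and> almost_complex_structure S J \<and>
     (\<forall>x\<in>pts S. \<forall>u\<in>tangent_space S x. \<forall>w\<in>tangent_space S x. g x (J x u) (J x w) = g x u w) \<and>
     (\<exists>D. levi_civita S g D \<and> parallel_endo S D J)"


section \<open>Complex-valued differential forms\<close>

text \<open>A form takes its \<open>k\<close> arguments as a list of length \<open>k\<close>.\<close>

type_synonym 'a cform = "'a \<Rightarrow> 'a tvec list \<Rightarrow> complex"

definition complex_form ::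
  "('a, 'e::euclidean_space) manifold \<Rightarrow> nat \<Rightarrow> 'a cform \<Rightarrow> bool" where
  "complex_form S k \<omega> \<longleftrightarrow>
     (\<forall>x\<in>pts S. \<forall>us. length us = k \<and> set us \<subseteq> tangent_space S x \<longrightarrow>
        (\<forall>i<k. \<forall>u\<in>tangent_space S x. \<forall>w\<in>tangent_space S x. \<forall>a b.
           \<omega> x (us[i := tv_comb a u b w]) =
             of_real a * \<omega> x (us[i := u]) + of_real b * \<omega> x (us[i := w])) \<and>
        (\<forall>i j. i < j \<and> j < k \<and> us ! i = us ! j \<longrightarrow> \<omega> x us = 0)) \<and>
     (\<forall>Xs. length Xs = k \<and> set Xs \<subseteq> vector_fields S \<longrightarrow>
        smooth_fun S (\<lambda>x. \<omega> x (map (\<lambda>X. X x) Xs)))"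

definition form_zero :: "('a, 'e::euclidean_space) manifold \<Rightarrow> nat \<Rightarrow> 'a cform \<Rightarrow> bool" where
  "form_zero S k \<omega> \<longleftrightarrow>
     (\<forall>x\<in>pts S. \<forall>us. length us = k \<and> set us \<subseteq> tangent_space S x \<longrightarrow> \<omega> x us = 0)"

definition tv_complex :: "'a tvec \<Rightarrow> ('a \<Rightarrow> complex) \<Rightarrow> complex" where
  "tv_complex u h = Complex (u (\<lambda>y. Re (h y))) (u (\<lambda>y. Im (h y)))"

definition omit :: "nat \<Rightarrow> 'b list \<Rightarrow> 'b list" where
  "omit i xs = take i xs @ drop (Suc i) xs"

definition ext_deriv_formula ::
  "('a, 'e::euclidean_space) manifold \<Rightarrow> 'a cform \<Rightarrow> 'a vfield list \<Rightarrow> 'a \<Rightarrow> complex" where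
  "ext_deriv_formula S \<omega> Xs x =
     (\<Sum>i<length Xs. (-1) ^ i *
        tv_complex ((Xs ! i) x) (\<lambda>y. \<omega> y (map (\<lambda>X. X y) (omit i Xs)))) +
     (\<Sum>j<length Xs. \<Sum>i<j. (-1) ^ (i + j) *
        \<omega> x (map (\<lambda>X. X x) (lie_bracket S (Xs ! i) (Xs ! j) # omit i (omit j Xs))))"

text \<open>\<open>has_ext_deriv S k \<omega> \<eta>\<close> says \<open>d\<omega> = \<eta>\<close> for a \<open>k\<close>-form \<open>\<omega>\<close>. As every tangent vector
  extends to a vector field, \<open>\<eta>\<close> is determined by \<open>\<omega>\<close>; the same applies to the other relations
  of this kind below.\<close>

definition has_ext_deriv ::
  "('a, 'e::euclidean_space) manifold \<Rightarrow> nat \<Rightarrow> 'a cform \<Rightarrow> 'a cform \<Rightarrow> bool" where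
  "has_ext_deriv S k \<omega> \<eta> \<longleftrightarrow>
     complex_form S k \<omega> \<and> complex_form S (Suc k) \<eta> \<and>
     (\<forall>Xs. length Xs = Suc k \<and> set Xs \<subseteq> vector_fields S \<longrightarrow>
        (\<forall>x\<in>pts S. \<eta> x (map (\<lambda>X. X x) Xs) = ext_deriv_formula S \<omega> Xs x))"

definition closed_form ::
  "('a, 'e::euclidean_space) manifold \<Rightarrow> nat \<Rightarrow> 'a cform \<Rightarrow> bool" where
  "closed_form S k \<omega> \<longleftrightarrow> has_ext_deriv S k \<omega> (\<lambda>x us. 0)"


section \<open>Type decomposition and the Dolbeault operators\<close>

text \<open>A pair \<open>(u, w)\<close> of tangent vectors at \<open>x\<close> stands for the element \<open>u + \<i> w\<close> of the
  complexified tangent space. The two subspaces below are the eigenspaces of \<open>J\<close> for \<open>\<i>\<close> and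
  \<open>- \<i>\<close>.\<close>

definition T10 :: "('a, 'e::euclidean_space) manifold \<Rightarrow> 'a endo \<Rightarrow> 'a \<Rightarrow> ('a tvec \<times> 'a tvec) set" where
  "T10 S J x = {(u, w). u \<in> tangent_space S x \<and> w \<in> tangent_space S x \<and>
     J x u = tv_minus w \<and> J x w = u}"

definition T01 :: "('a, 'e::euclidean_space) manifold \<Rightarrow> 'a endo \<Rightarrow> 'a \<Rightarrow> ('a tvec \<times> 'a tvec) set" where
  "T01 S J x = {(u, w). u \<in> tangent_space S x \<and> w \<in> tangent_space S x \<and>
     J x u = w \<and> J x w = tv_minus u}"

text \<open>The complex-multilinear extension of a form: expand the value at the vectors
  \<open>u\<^sub>j + \<i> w\<^sub>j\<close>, where \<open>A\<close> is the set of slots from which the \<open>\<i> w\<^sub>j\<close> summand is taken.\<close>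

definition complexify :: "'a cform \<Rightarrow> 'a \<Rightarrow> ('a tvec \<times> 'a tvec) list \<Rightarrow> complex" where
  "complexify \<omega> x zs = (\<Sum>A\<in>Pow {..<length zs}. \<i> ^ card A *
     \<omega> x (map (\<lambda>j. if j \<in> A then snd (zs ! j) else fst (zs ! j)) [0..<length zs]))"

definition pq_form ::
  "('a, 'e::euclidean_space) manifold \<Rightarrow> 'a endo \<Rightarrow> nat \<Rightarrow> nat \<Rightarrow> 'a cform \<Rightarrow> bool" where
  "pq_form S J p q \<omega> \<longleftrightarrow>
     complex_form S (p + q) \<omega> \<and>
     (\<forall>x\<in>pts S. \<forall>A\<subseteq>{..<p + q}. \<forall>zs. card A \<noteq> p \<and> length zs = p + q \<and>
        (\<forall>j<p + q. zs ! j \<in> (if j \<in> A then T10 S J x else T01 S J x)) \<longrightarrow>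
        complexify \<omega> x zs = 0)"

text \<open>\<open>dolbeault S J p q \<omega> \<eta> \<theta>\<close> says that \<open>\<omega>\<close> is a \<open>(p, q)\<close> form with \<open>\<partial>\<omega> = \<eta>\<close> and
  \<open>\<partial>\<close>-bar \<open>\<omega> = \<theta>\<close>, the two operators being defined by the decomposition
  of \<open>d\<omega>\<close> into its \<open>(p + 1, q)\<close> and \<open>(p, q + 1)\<close> parts. It is used for integrable \<open>J\<close>.\<close>

definition dolbeault ::
  "('a, 'e::euclidean_space) manifold \<Rightarrow> 'a endo \<Rightarrow> nat \<Rightarrow> nat \<Rightarrow>
     'a cform \<Rightarrow> 'a cform \<Rightarrow> 'a cform \<Rightarrow> bool" where
  "dolbeault S J p q \<omega> \<eta> \<theta> \<longleftrightarrow>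
     pq_form S J p q \<omega> \<and> pq_form S J (Suc p) q \<eta> \<and> pq_form S J p (Suc q) \<theta> \<and>
     has_ext_deriv S (p + q) \<omega> (\<lambda>x us. \<eta> x us + \<theta> x us)"

text \<open>In the next three definitions \<open>\<sigma>\<close> is a \<open>(p, q)\<close> form. The only form with a negative
  index in its type is zero.\<close>

definition del_exact ::
  "('a, 'e::euclidean_space) manifold \<Rightarrow> 'a endo \<Rightarrow> nat \<Rightarrow> nat \<Rightarrow> 'a cform \<Rightarrow> bool" where
  "del_exact S J p q \<sigma> \<longleftrightarrow>
     (case p of 0 \<Rightarrow> form_zero S (p + q) \<sigma> | Suc p' \<Rightarrow> \<exists>\<tau> \<theta>. dolbeault S J p' q \<tau> \<sigma> \<theta>)"

definition delbar_exact ::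
  "('a, 'e::euclidean_space) manifold \<Rightarrow> 'a endo \<Rightarrow> nat \<Rightarrow> nat \<Rightarrow> 'a cform \<Rightarrow> bool" where
  "delbar_exact S J p q \<sigma> \<longleftrightarrow>
     (case q of 0 \<Rightarrow> form_zero S (p + q) \<sigma> | Suc q' \<Rightarrow> \<exists>\<tau> \<eta>. dolbeault S J p q' \<tau> \<eta> \<sigma>)"

definition deldelbar_exact ::
  "('a, 'e::euclidean_space) manifold \<Rightarrow> 'a endo \<Rightarrow> nat \<Rightarrow> nat \<Rightarrow> 'a cform \<Rightarrow> bool" where
  "deldelbar_exact S J p q \<sigma> \<longleftrightarrow>
     (if p = 0 \<or> q = 0 then form_zero S (p + q) \<sigma>
      else \<exists>lam \<eta> \<nu> \<theta>. dolbeault S J (p - 1) (q - 1) lam \<eta> \<nu> \<and> dolbeault S J (p - 1) q \<nu> \<sigma> \<theta>)"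

definition deldelbar_property ::
  "('a, 'e::euclidean_space) manifold \<Rightarrow> 'a endo \<Rightarrow> bool" where
  "deldelbar_property S J \<longleftrightarrow>
     (\<forall>p q \<sigma>. pq_form S J p q \<sigma> \<and> closed_form S (p + q) \<sigma> \<and>
        (del_exact S J p q \<sigma> \<or> delbar_exact S J p q \<sigma>) \<longrightarrow> deldelbar_exact S J p q \<sigma>)"


section \<open>Killing and real holomorphic vector fields\<close>

definition lie_deriv_metric ::
  "('a, 'e::euclidean_space) manifold \<Rightarrow> 'a vfield \<Rightarrow> 'a metric \<Rightarrow> 'a vfield \<Rightarrow> 'a vfield \<Rightarrow> 'a \<Rightarrow> real" where
  "lie_deriv_metric S v g X Y x =
     v x (\<lambda>y. g y (X y) (Y y)) - g x (lie_bracket S v X x) (Y x) - g x (X x) (lie_bracket S v Y x)"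

definition killing_field ::
  "('a, 'e::euclidean_space) manifold \<Rightarrow> 'a metric \<Rightarrow> 'a vfield \<Rightarrow> bool" where
  "killing_field S g v \<longleftrightarrow> v \<in> vector_fields S \<and>
     (\<forall>X\<in>vector_fields S. \<forall>Y\<in>vector_fields S. \<forall>x\<in>pts S. lie_deriv_metric S v g X Y x = 0)"

definition lie_deriv_endo ::
  "('a, 'e::euclidean_space) manifold \<Rightarrow> 'a vfield \<Rightarrow> 'a endo \<Rightarrow> 'a vfield \<Rightarrow> 'a vfield" where
  "lie_deriv_endo S v J X = (\<lambda>x.
     tv_comb 1 (lie_bracket S v (\<lambda>y. J y (X y)) x) (-1) (J x (lie_bracket S v X x)))"

definition real_holomorphic ::
  "('a, 'e::euclidean_space) manifold \<Rightarrow> 'a endo \<Rightarrow> 'a vfield \<Rightarrow> bool" where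
  "real_holomorphic S J v \<longleftrightarrow> v \<in> vector_fields S \<and>
     (\<forall>X\<in>vector_fields S. \<forall>x\<in>pts S. lie_deriv_endo S v J X x = tv_zero)"

end

theory Submission
  imports Defs
begin

text \<open>Let \<open>\<omega> = g(J \<cdot>, \<cdot>)\<close> be the Kaehler form and \<open>v\<close> a Killing field. As \<open>v\<close> preserves \<open>g\<close>, the
  form \<open>\<alpha> = L\<^sub>v \<omega>\<close> is \<open>g((L\<^sub>v J) \<cdot>, \<cdot>)\<close>, so \<open>v\<close> is real holomorphic as soon as \<open>\<alpha> = 0\<close>. Since
  \<open>L\<^sub>v J\<close> anticommutes with \<open>J\<close>, \<open>\<alpha>\<close> is the real part of twice a form \<open>\<sigma>\<close> of type \<open>(2, 0)\<close>; since
  \<open>\<omega>\<close> is closed, \<open>\<alpha> = d \<beta>\<close> for \<open>\<beta> = \<omega>(v, \<cdot>)\<close>. Comparing types, \<open>d \<alpha> = 0\<close> gives \<open>d \<sigma> = 0\<close>, and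
  \<open>\<sigma>\<close> is \<open>\<partial>\<close> of the \<open>(1, 0)\<close> part of \<open>\<beta>\<close>. A closed \<open>\<partial>\<close>-exact form of type \<open>(2, 0)\<close> on a
  \<open>\<partial>\<close>-\<open>\<partial>\<close>-bar manifold is zero, because there are no forms of type \<open>(1, -1)\<close>.

  To carry this out with tensors at a point, everything is written through the Levi-Civita
  connection \<open>\<nabla>\<close>. The bilinear form \<open>a(u, w) = g(\<nabla>\<^sub>u v, w)\<close> is skew by the Killing equation
  (\<open>nabla_two_form\<close>), and

  \<^item> \<open>\<alpha>(u, w) = - a(u, J w) - a(J u, w)\<close>,
  \<^item> \<open>\<sigma>(u, w) = (\<alpha>(u, w) - \<i> \<alpha>(J u, w)) / 2\<close>,
  \<^item> the \<open>\<partial>\<close>-bar derivative of the \<open>(1, 0)\<close> part of \<open>\<beta>\<close> is \<open>- \<i> (a(u, w) + a(J u, J w)) / 2\<close>.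

  The two halves of the argument are \<open>dolbeault_beta10\<close> and \<open>closed_sigma20\<close>; the latter rests on
  \<open>closed_imp_closed_compose_J\<close>, the statement that \<open>\<alpha>(J \<cdot>, \<cdot>)\<close> is closed along with \<open>\<alpha>\<close>.

  The Killing equation and the exterior derivative speak of vector fields, while skewness and
  type are conditions on arbitrary tangent vectors, which are derivations of the algebra of smooth
  functions. The bridge is \<open>tangent_extends_to_vector_field\<close>: a derivation at a point is a
  directional derivative in a chart, by Hadamard's lemma, and a bump function spreads it to a
  global vector field.\<close>


section \<open>Calculus of \<open>C\<^sup>k\<close> functions\<close>

lemma Ck_on_cong:
  assumes "open S" "\<And>x. x \<in> S \<Longrightarrow> f x = h x" "Ck_on k f S"
  shows "Ck_on k h S"
  using assms(2,3)
proof (induction k arbitrary: f h)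
  case 0
  then show ?case by (simp cong: continuous_on_cong)
next
  case (Suc k)
  have h': "(h has_derivative frechet_derivative f (at x)) (at x)" if x: "x \<in> S" for x
  proof (rule has_derivative_transform_within_open[OF _ assms(1) x])
    show "(f has_derivative frechet_derivative f (at x)) (at x)"
      using Suc.prems(2) x by (simp add: frechet_derivative_works)
  qed (use Suc.prems(1) in auto)
  have "Ck_on k (\<lambda>x. frechet_derivative h (at x) v) S" for v
  proof (rule Suc.IH)
    show "Ck_on k (\<lambda>x. frechet_derivative f (at x) v) S"
      using Suc.prems(2) by simp
  qed (simp add: frechet_derivative_at[OF h', symmetric])
  then show ?case using h' by (auto simp: differentiable_def)
qed

lemma Ck_on_Suc_intro:
  assumes "open S" "\<And>x. x \<in> S \<Longrightarrow> (f has_derivative f' x) (at x)"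
    and "\<And>v. Ck_on k (\<lambda>x. f' x v) S"
  shows "Ck_on (Suc k) f S"
proof -
  have "Ck_on k (\<lambda>x. frechet_derivative f (at x) v) S" for v
    by (rule Ck_on_cong[OF assms(1) _ assms(3)[of v]])
       (simp add: frechet_derivative_at[OF assms(2), symmetric])
  then show ?thesis using assms(2) by (auto simp: differentiable_def)
qed

lemma Ck_on_Suc_derivative:
  "Ck_on (Suc k) f S \<Longrightarrow> x \<in> S \<Longrightarrow> (f has_derivative frechet_derivative f (at x)) (at x)"
  by (simp add: frechet_derivative_works)

lemma Ck_on_subset: "Ck_on k f S \<Longrightarrow> T \<subseteq> S \<Longrightarrow> Ck_on k f T"
  by (induction k arbitrary: f) (auto intro: continuous_on_subset)

lemma Ck_on_lower: "Ck_on (Suc k) f S \<Longrightarrow> Ck_on k f S"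
proof (induction k arbitrary: f)
  case 0
  then show ?case
    by (auto intro!: continuous_at_imp_continuous_on differentiable_imp_continuous_within)
next
  case (Suc k)
  have "Ck_on k (\<lambda>x. frechet_derivative f (at x) v) S" for v
    by (rule Suc.IH) (use Suc.prems in simp)
  with Suc.prems show ?case by simp
qed

lemma Ck_on_Suc_0: "Ck_on (Suc k) f S \<Longrightarrow> Ck_on (Suc 0) f S"
proof (induction k)
  case (Suc k)
  show ?case by (rule Suc.IH[OF Ck_on_lower[OF Suc.prems]])
qed

lemma Ck_on_Un:
  assumes "open S" "open T" "Ck_on k f S" "Ck_on k f T"
  shows "Ck_on k f (S \<union> T)"
  using assms(3,4)
  by (induction k arbitrary: f) (auto intro: continuous_on_open_Un assms)

lemma Ck_on_const: "open S \<Longrightarrow> Ck_on k (\<lambda>x. c) S"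
proof (induction k arbitrary: c)
  case (Suc k)
  show ?case by (rule Ck_on_Suc_intro[OF Suc.prems has_derivative_const]) (use Suc in simp)
qed simp

lemma Ck_on_linear_compose:
  assumes "bounded_linear L" "open S" "Ck_on k f S"
  shows "Ck_on k (\<lambda>x. L (f x)) S"
  using assms(3)
proof (induction k arbitrary: f)
  case 0
  then show ?case by (simp add: bounded_linear.continuous_on[OF assms(1)])
next
  case (Suc k)
  show ?case
  proof (rule Ck_on_Suc_intro[OF assms(2)])
    show "((\<lambda>x. L (f x)) has_derivative (\<lambda>v. L (frechet_derivative f (at x) v))) (at x)"
      if "x \<in> S" for x
      by (rule bounded_linear.has_derivative[OF assms(1) Ck_on_Suc_derivative[OF Suc.prems that]])
    show "Ck_on k (\<lambda>x. L (frechet_derivative f (at x) v)) S" for v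
      using Suc by simp
  qed
qed

lemma Ck_on_add:
  assumes "open S" "Ck_on k f S" "Ck_on k h S"
  shows "Ck_on k (\<lambda>x. f x + h x) S"
  using assms(2,3)
proof (induction k arbitrary: f h)
  case 0
  then show ?case by (simp add: continuous_on_add)
next
  case (Suc k)
  show ?case
  proof (rule Ck_on_Suc_intro[OF assms(1)])
    show "((\<lambda>x. f x + h x) has_derivative
        (\<lambda>v. frechet_derivative f (at x) v + frechet_derivative h (at x) v)) (at x)"
      if "x \<in> S" for x
      by (rule has_derivative_add) (use Suc.prems that in \<open>auto intro: Ck_on_Suc_derivative\<close>)
    show "Ck_on k (\<lambda>x. frechet_derivative f (at x) v + frechet_derivative h (at x) v) S" for v
      using Suc by simp
  qed
qed

lemma Ck_on_sum:
  assumes "open S" "\<And>i. i \<in> I \<Longrightarrow> Ck_on k (f i) S"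
  shows "Ck_on k (\<lambda>x. \<Sum>i\<in>I. f i x) S"
  using assms(2)
  by (induction I rule: infinite_finite_induct) (auto intro: Ck_on_const Ck_on_add assms(1))

lemma Ck_on_mult:
  fixes f h :: "_ \<Rightarrow> real"
  assumes "open S" "Ck_on k f S" "Ck_on k h S"
  shows "Ck_on k (\<lambda>x. f x * h x) S"
  using assms(2,3)
proof (induction k arbitrary: f h)
  case 0
  then show ?case by (simp add: continuous_on_mult)
next
  case (Suc k)
  show ?case
  proof (rule Ck_on_Suc_intro[OF assms(1)])
    show "((\<lambda>x. f x * h x) has_derivative
        (\<lambda>v. f x * frechet_derivative h (at x) v + frechet_derivative f (at x) v * h x)) (at x)"
      if "x \<in> S" for x
      by (rule has_derivative_mult) (use Suc.prems that in \<open>auto intro: Ck_on_Suc_derivative\<close>)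
    show "Ck_on k (\<lambda>x. f x * frechet_derivative h (at x) v + frechet_derivative f (at x) v * h x) S"
      for v
    proof (intro Ck_on_add[OF assms(1)] Suc.IH)
    qed (use Suc.prems Ck_on_lower in auto)
  qed
qed

lemma Ck_on_ident: "open S \<Longrightarrow> Ck_on k (\<lambda>x. x) S"
proof (cases k)
  case (Suc n)
  assume "open S"
  then show ?thesis unfolding Suc
    by (intro Ck_on_Suc_intro[OF _ has_derivative_ident] Ck_on_const)
qed simp

text \<open>The chain rule expresses a directional derivative of the composite through the partial
  derivatives of \<open>f\<close>, to which the induction hypothesis applies; this is why the middle space has a
  finite basis.\<close>

lemma Ck_on_compose:
  fixes f :: "'b::euclidean_space \<Rightarrow> real" and h :: "'a::real_normed_vector \<Rightarrow> 'b"
  assumes "open S" "open T" "h ` S \<subseteq> T" "Ck_on k f T" "Ck_on k h S"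
  shows "Ck_on k (\<lambda>x. f (h x)) S"
  using assms(4,5)
proof (induction k arbitrary: f)
  case 0
  then show ?case using assms(3) continuous_on_compose2[of T f S h] by simp
next
  case (Suc k)
  let ?f' = "\<lambda>x. frechet_derivative f (at x)" and ?h' = "\<lambda>x. frechet_derivative h (at x)"
  show ?case
  proof (rule Ck_on_Suc_intro[OF assms(1)])
    fix x assume x: "x \<in> S"
    then have hx: "h x \<in> T" using assms(3) by auto
    note f' = Ck_on_Suc_derivative[OF Suc.prems(1) hx]
    have chain: "((\<lambda>x. f (h x)) has_derivative (\<lambda>v. ?f' (h x) (?h' x v))) (at x)"
      using has_derivative_compose[OF Ck_on_Suc_derivative[OF Suc.prems(2) x] f'] .
    have expand: "?f' (h x) w = (\<Sum>i\<in>Basis. (w \<bullet> i) * ?f' (h x) i)" for w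
    proof -
      have l: "linear (?f' (h x))"
        using f' has_derivative_bounded_linear bounded_linear.linear by blast
      have "?f' (h x) w = ?f' (h x) (\<Sum>i\<in>Basis. (w \<bullet> i) *\<^sub>R i)"
        by (simp add: euclidean_representation)
      also have "\<dots> = (\<Sum>i\<in>Basis. (w \<bullet> i) * ?f' (h x) i)"
        by (simp add: linear_sum[OF l] linear_cmul[OF l])
      finally show ?thesis .
    qed
    show "((\<lambda>x. f (h x)) has_derivative
        (\<lambda>v. \<Sum>i\<in>Basis. (?h' x v \<bullet> i) * ?f' (h x) i)) (at x)"
      using chain by (subst expand[symmetric])
  next
    fix v
    have "Ck_on k (\<lambda>x. ?f' (h x) i) S" for i
      by (rule Suc.IH[of "\<lambda>y. ?f' y i", OF _ Ck_on_lower[OF Suc.prems(2)]])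
         (use Suc.prems(1) in simp)
    moreover have "Ck_on k (\<lambda>x. ?h' x v \<bullet> i) S" for i
      using Suc.prems by (intro Ck_on_linear_compose[OF bounded_linear_inner_left assms(1)]) simp
    ultimately show "Ck_on k (\<lambda>x. \<Sum>i\<in>Basis. (?h' x v \<bullet> i) * ?f' (h x) i) S"
      by (intro Ck_on_sum[OF assms(1)] Ck_on_mult[OF assms(1)])
  qed
qed


lemma smooth_on_cong:
  "open S \<Longrightarrow> (\<And>x. x \<in> S \<Longrightarrow> f x = h x) \<Longrightarrow> smooth_on f S \<Longrightarrow> smooth_on h S"
  unfolding smooth_on_def using Ck_on_cong by blast

lemma smooth_on_const: "open S \<Longrightarrow> smooth_on (\<lambda>x. c) S"
  by (simp add: smooth_on_def Ck_on_const)

lemma smooth_on_linear_compose: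
  "bounded_linear L \<Longrightarrow> open S \<Longrightarrow> smooth_on f S \<Longrightarrow> smooth_on (\<lambda>x. L (f x)) S"
  by (simp add: smooth_on_def Ck_on_linear_compose)

lemma smooth_on_add:
  "open S \<Longrightarrow> smooth_on f S \<Longrightarrow> smooth_on h S \<Longrightarrow> smooth_on (\<lambda>x. f x + h x) S"
  by (simp add: smooth_on_def Ck_on_add)

lemma smooth_on_mult:
  fixes f h :: "_ \<Rightarrow> real"
  shows "open S \<Longrightarrow> smooth_on f S \<Longrightarrow> smooth_on h S \<Longrightarrow> smooth_on (\<lambda>x. f x * h x) S"
  by (simp add: smooth_on_def Ck_on_mult)

lemma smooth_on_directional_derivative:
  "smooth_on f S \<Longrightarrow> smooth_on (\<lambda>x. frechet_derivative f (at x) v) S"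
  unfolding smooth_on_def by (metis Ck_on.simps(2))

lemma smooth_on_has_derivative:
  "smooth_on f S \<Longrightarrow> x \<in> S \<Longrightarrow> (f has_derivative frechet_derivative f (at x)) (at x)"
  unfolding smooth_on_def using Ck_on_Suc_derivative by blast

lemma smooth_on_subset: "smooth_on f S \<Longrightarrow> T \<subseteq> S \<Longrightarrow> smooth_on f T"
  unfolding smooth_on_def using Ck_on_subset by blast

lemma smooth_on_Un:
  "open S \<Longrightarrow> open T \<Longrightarrow> smooth_on f S \<Longrightarrow> smooth_on f T \<Longrightarrow> smooth_on f (S \<union> T)"
  unfolding smooth_on_def using Ck_on_Un by blast

lemma smooth_on_compose:
  fixes f :: "'b::euclidean_space \<Rightarrow> real" and h :: "'a::real_normed_vector \<Rightarrow> 'b"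
  shows "open S \<Longrightarrow> open T \<Longrightarrow> h ` S \<subseteq> T \<Longrightarrow> smooth_on f T \<Longrightarrow> smooth_on h S \<Longrightarrow>
    smooth_on (\<lambda>x. f (h x)) S"
  unfolding smooth_on_def using Ck_on_compose by blast


section \<open>Bump functions\<close>

text \<open>The derivatives of \<open>exp (- 1 / t)\<close>, extended by zero to \<open>t \<le> 0\<close>, are combinations of these
  functions, so that smoothness can be proved for all of them by one induction.\<close>

definition exp_flat :: "nat \<Rightarrow> real \<Rightarrow> real" where
  "exp_flat n t = (if t > 0 then (1 / t) ^ n * exp (- 1 / t) else 0)"

lemma exp_flat_tendsto_0: "((exp_flat n) \<longlongrightarrow> 0) (at 0)"
proof -
  have "((\<lambda>t::real. (1 / t) ^ n * exp (- 1 / t)) \<longlongrightarrow> 0) (at_right 0)"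
  proof -
    have "((\<lambda>s::real. s ^ n / exp s) \<longlongrightarrow> 0) at_top" by (rule tendsto_power_div_exp_0)
    from filterlim_compose[OF this filterlim_inverse_at_top_right] show ?thesis
      by (simp add: exp_minus field_simps)
  qed
  then have "(exp_flat n \<longlongrightarrow> 0) (at_right 0)"
    by (rule Lim_transform_eventually)
       (auto simp: exp_flat_def eventually_at_filter)
  moreover have "(exp_flat n \<longlongrightarrow> 0) (at_left 0)"
    by (rule Lim_transform_eventually[OF tendsto_const])
       (auto simp: exp_flat_def eventually_at_filter)
  ultimately show ?thesis by (simp add: filterlim_split_at)
qed

lemma exp_flat_has_derivative:
  "(exp_flat n has_real_derivative exp_flat (n + 2) t - n * exp_flat (n + 1) t) (at t)"
proof -
  consider "t > 0" | "t < 0" | "t = 0" by linarith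
  then show ?thesis
  proof cases
    case 1
    have inv: "((\<lambda>t. 1 / t) has_real_derivative - ((1 / t) * (1 / t))) (at t)"
      using DERIV_inverse[of t] 1 by (simp add: inverse_eq_divide power2_eq_square)
    have "((\<lambda>t. (1 / t) ^ n * exp (- (1 / t))) has_real_derivative
        (1 / t) ^ n * (exp (- (1 / t)) * - (- ((1 / t) * (1 / t)))) +
        real n * (1 / t) ^ (n - Suc 0) * - ((1 / t) * (1 / t)) * exp (- (1 / t))) (at t)"
      using DERIV_mult'[OF DERIV_power[OF inv, of n] DERIV_chain2[OF DERIV_exp DERIV_minus[OF inv]]]
      by (simp add: mult_ac)
    moreover have "real n * (1 / t) ^ (n - Suc 0) * ((1 / t) * (1 / t)) = real n * (1 / t) ^ (n + 1)"
      by (cases n) (simp_all add: mult_ac)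
    then have "(1 / t) ^ n * (exp (- (1 / t)) * - (- ((1 / t) * (1 / t)))) +
        real n * (1 / t) ^ (n - Suc 0) * - ((1 / t) * (1 / t)) * exp (- (1 / t)) =
        (1 / t) ^ (n + 2) * exp (- (1 / t)) - real n * (1 / t) ^ (n + 1) * exp (- (1 / t))"
      by (simp only: power_add power2_eq_square mult_minus_left mult_minus_right) (simp add: mult_ac)
    ultimately have "((\<lambda>t. (1 / t) ^ n * exp (- 1 / t)) has_real_derivative
        exp_flat (n + 2) t - n * exp_flat (n + 1) t) (at t)"
      using 1 by (simp add: exp_flat_def mult.assoc)
    then show ?thesis
      by (rule has_field_derivative_transform_within_open[of _ _ _ "{0<..}"])
         (use 1 in \<open>auto simp: exp_flat_def\<close>)
  next
    case 2
    have "((\<lambda>t. 0) has_real_derivative exp_flat (n + 2) t - n * exp_flat (n + 1) t) (at t)"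
      using 2 by (auto simp: exp_flat_def)
    then show ?thesis
      by (rule has_field_derivative_transform_within_open[of _ _ _ "{..<0}"])
         (use 2 in \<open>auto simp: exp_flat_def\<close>)
  next
    case 3
    have "((\<lambda>y. (exp_flat n y - exp_flat n 0) / (y - 0)) \<longlongrightarrow> 0) (at 0)"
      by (rule Lim_transform_eventually[OF exp_flat_tendsto_0[of "Suc n"]])
         (auto simp: exp_flat_def eventually_at_filter)
    then show ?thesis
      using 3 by (simp add: has_field_derivative_iff exp_flat_def)
  qed
qed

lemma Ck_on_exp_flat: "Ck_on k (exp_flat n) UNIV"
proof (induction k arbitrary: n)
  case 0
  show ?case
    by (simp, rule DERIV_continuous_on[OF has_field_derivative_at_within[OF exp_flat_has_derivative]])
next
  case (Suc k)
  show ?case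
  proof (rule Ck_on_Suc_intro[OF open_UNIV])
    show "(exp_flat n has_derivative (*) (exp_flat (n + 2) t + (- real n) * exp_flat (n + 1) t)) (at t)" for t
      using exp_flat_has_derivative[of n t] by (simp add: has_field_derivative_def)
    show "Ck_on k (\<lambda>t. (exp_flat (n + 2) t + (- real n) * exp_flat (n + 1) t) * v) UNIV" for v
      by (intro Ck_on_mult Ck_on_add Ck_on_const Suc) auto
  qed
qed

text \<open>A multiple of \<open>exp (- 1 / s)\<close> at \<open>s = r\<^sup>2 - |z - p|\<^sup>2\<close>.\<close>

lemma exists_bump:
  fixes p :: "'e::euclidean_space"
  assumes "r > 0"
  obtains \<rho> :: "'e \<Rightarrow> real"
  where "smooth_on \<rho> UNIV" "\<rho> p = 1" "\<And>z. z \<notin> cball p r \<Longrightarrow> \<rho> z = 0"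
proof
  let ?q = "\<lambda>z. r\<^sup>2 + (- 1) * (\<Sum>i\<in>Basis. ((z - p) \<bullet> i) * ((z - p) \<bullet> i))"
  let ?\<rho> = "\<lambda>z. exp_flat 0 (?q z) * inverse (exp_flat 0 (r\<^sup>2))"
  have q: "?q z = r\<^sup>2 - (norm (z - p))\<^sup>2" for z
    by (simp only: power2_norm_eq_inner euclidean_inner[of "z - p" "z - p"]) 
  have "Ck_on k (\<lambda>z. z - p) UNIV" for k
    using Ck_on_add[OF open_UNIV Ck_on_ident[OF open_UNIV] Ck_on_const[OF open_UNIV, of k "- p"]]
    by simp
  then have "Ck_on k ?q UNIV" for k
    by (intro Ck_on_add Ck_on_mult Ck_on_sum Ck_on_const open_UNIV
        Ck_on_linear_compose[OF bounded_linear_inner_left])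
  then show "smooth_on ?\<rho> UNIV"
    unfolding smooth_on_def
    by (intro allI Ck_on_mult Ck_on_const open_UNIV Ck_on_compose[OF _ open_UNIV _ Ck_on_exp_flat]) auto
  show "?\<rho> p = 1" using assms by (simp add: exp_flat_def)
  show "?\<rho> z = 0" if "z \<notin> cball p r" for z
  proof -
    have "r\<^sup>2 \<le> (norm (z - p))\<^sup>2"
      using that assms by (intro power_mono) (auto simp: dist_norm norm_minus_commute)
    then show ?thesis unfolding q by (simp add: exp_flat_def)
  qed
qed


section \<open>Hadamard's lemma\<close>

text \<open>The coefficients in Hadamard's lemma are such means with \<open>m = 0\<close>. Each differentiation under the
  integral produces a factor \<open>t\<close>, so the family with all powers of \<open>t\<close> is closed under directional
  derivatives, and smoothness follows by induction.\<close>

definition ray_mean :: "'e::euclidean_space \<Rightarrow> nat \<Rightarrow> ('e \<Rightarrow> real) \<Rightarrow> 'e \<Rightarrow> real" where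
  "ray_mean p m f z = integral {0..1} (\<lambda>t. t ^ m * f (p + t *\<^sub>R (z - p)))"

lemma segment_in_ball:
  fixes z p :: "'e::real_normed_vector"
  assumes "z \<in> ball p R" "t \<in> {0..1}"
  shows "p + t *\<^sub>R (z - p) \<in> ball p R"
proof -
  have "\<bar>t\<bar> * norm (z - p) \<le> 1 * norm (z - p)"
    using assms(2) by (intro mult_right_mono) auto
  then show ?thesis using assms(1) by (simp add: dist_norm norm_minus_commute)
qed

lemma continuous_on_ray:
  fixes f :: "'e::euclidean_space \<Rightarrow> real"
  assumes "continuous_on (ball p R) f"
  shows "continuous_on (ball p R \<times> {0..1}) (\<lambda>(z, t). t ^ m * f (p + t *\<^sub>R (z - p)))"
proof -
  have "continuous_on (ball p R \<times> {0..1}) (\<lambda>x. f (p + snd x *\<^sub>R (fst x - p)))"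
    by (rule continuous_on_compose2[OF assms])
       (use segment_in_ball[of _ p R] in \<open>auto intro!: continuous_intros simp del: mem_ball\<close>)
  then show ?thesis
    unfolding case_prod_beta by (intro continuous_intros)
qed

lemma integrable_on_ray:
  fixes f :: "'e::euclidean_space \<Rightarrow> real"
  assumes "continuous_on (ball p R) f" "z \<in> ball p R"
  shows "(\<lambda>t. t ^ m * f (p + t *\<^sub>R (z - p))) integrable_on {0..1}"
  by (intro integrable_continuous_interval continuous_intros continuous_on_compose2[OF assms(1)])
     (use segment_in_ball[OF assms(2)] in force)

text \<open>Differentiation under the integral sign.\<close>

lemma ray_mean_has_derivative:
  fixes f :: "'e::euclidean_space \<Rightarrow> real"
  assumes f: "Ck_on (Suc 0) f (ball p R)" and z: "z \<in> ball p R"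
  shows "(ray_mean p m f has_derivative
    (\<lambda>v. ray_mean p (Suc m) (\<lambda>y. frechet_derivative f (at y) v) z)) (at z)"
proof -
  let ?f' = "\<lambda>x. frechet_derivative f (at x)"
  let ?B = "ball p R"
  define G where "G z t = Blinfun (\<lambda>v. t ^ Suc m * ?f' (p + t *\<^sub>R (z - p)) v)" for z t
  have f': "(f has_derivative ?f' y) (at y)" if "y \<in> ?B" for y
    using Ck_on_Suc_derivative[OF f that] .
  have G: "blinfun_apply (G z t) = (\<lambda>v. t ^ Suc m * ?f' (p + t *\<^sub>R (z - p)) v)"
    if "z \<in> ?B" "t \<in> {0..1}" for z t
    unfolding G_def
    by (intro bounded_linear_Blinfun_apply bounded_linear_intros
        has_derivative_bounded_linear[OF f'] segment_in_ball that)
  have contf: "continuous_on ?B f" using Ck_on_lower[OF f] by simp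
  have deriv: "((\<lambda>z. t ^ m * f (p + t *\<^sub>R (z - p))) has_derivative blinfun_apply (G z t))
      (at z within ?B)" if "z \<in> ?B" "t \<in> cbox 0 1" for z t
  proof -
    have t: "t \<in> {0..1}" using that by simp
    note fz = f'[OF segment_in_ball[OF that(1) t]]
    have lin: "linear (?f' (p + t *\<^sub>R (z - p)))"
      using fz has_derivative_bounded_linear bounded_linear.linear by blast
    have "((\<lambda>z. p + t *\<^sub>R (z - p)) has_derivative (\<lambda>v. t *\<^sub>R v)) (at z)"
      by (auto intro!: derivative_eq_intros)
    from has_derivative_compose[OF this fz]
    have "((\<lambda>z. t ^ m * f (p + t *\<^sub>R (z - p))) has_derivative
        (\<lambda>v. t ^ m * ?f' (p + t *\<^sub>R (z - p)) (t *\<^sub>R v))) (at z)"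
      by (rule has_derivative_mult_right)
    then show ?thesis
      unfolding G[OF that(1) t] by (auto simp: linear_cmul[OF lin] mult_ac intro: has_derivative_at_withinI)
  qed
  have contG: "continuous_on (?B \<times> cbox 0 1) (\<lambda>(z, t). G z t)"
  proof (rule continuous_on_blinfun_componentwise)
    fix i :: 'e
    have "continuous_on ?B (\<lambda>y. ?f' y i)" using f by simp
    from continuous_on_ray[OF this, of "Suc m"]
    show "continuous_on (?B \<times> cbox 0 1) (\<lambda>x. blinfun_apply (case x of (z, t) \<Rightarrow> G z t) i)"
      unfolding box_real by (rule continuous_on_eq) (clarsimp simp: G)
  qed
  have leibniz: "((\<lambda>z. integral (cbox 0 1) (\<lambda>t. t ^ m * f (p + t *\<^sub>R (z - p)))) has_derivative
      integral (cbox 0 1) (G z)) (at z within ?B)"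
    by (rule leibniz_rule[OF deriv _ contG z]) (use integrable_on_ray[OF contf] in auto)
  have "blinfun_apply (integral (cbox 0 1) (G z)) v =
      ray_mean p (Suc m) (\<lambda>y. ?f' y v) z" for v
  proof -
    have "continuous_on (cbox 0 1) (G z)"
      using continuous_on_compose2[OF contG, of "cbox 0 1" "\<lambda>t. (z, t)"] z
      by (force intro!: continuous_on_Pair continuous_on_const continuous_on_id)
    then have "blinfun_apply (integral (cbox 0 1) (G z)) v = integral (cbox 0 1) (\<lambda>t. G z t v)"
      using integral_linear[OF integrable_continuous, of 0 1 "G z" "\<lambda>b. blinfun_apply b v"]
      by (simp add: o_def blinfun.bounded_linear_left)
    also have "\<dots> = ray_mean p (Suc m) (\<lambda>y. ?f' y v) z"
      unfolding ray_mean_def by (rule integral_cong[THEN trans]) (auto simp: G[OF z])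
    finally show ?thesis .
  qed
  then have "blinfun_apply (integral (cbox 0 1) (G z)) =
      (\<lambda>v. ray_mean p (Suc m) (\<lambda>y. ?f' y v) z)"
    by (rule ext)
  with leibniz show ?thesis
    using z by (simp add: at_within_open[OF z] ray_mean_def[abs_def])
qed

lemma Ck_on_ray_mean:
  fixes f :: "'e::euclidean_space \<Rightarrow> real"
  assumes "Ck_on k f (ball p R)"
  shows "Ck_on k (ray_mean p m f) (ball p R)"
  using assms
proof (induction k arbitrary: f m)
  case 0
  have "continuous_on (ball p R) (\<lambda>z. integral (cbox 0 1) (\<lambda>t. t ^ m * f (p + t *\<^sub>R (z - p))))"
    by (rule integral_continuous_on_param) (use continuous_on_ray[of p R f m] 0 in simp)
  then show ?case by (simp add: ray_mean_def[abs_def])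
next
  case (Suc k)
  show ?case
  proof (rule Ck_on_Suc_intro[OF open_ball ray_mean_has_derivative])
    show "Ck_on (Suc 0) f (ball p R)"
      using Suc.prems by (rule Ck_on_Suc_0)
    show "Ck_on k (\<lambda>x. ray_mean p (Suc m) (\<lambda>y. frechet_derivative f (at y) v) x) (ball p R)" for v
      using Suc by simp
  qed
qed

text \<open>The fundamental theorem of calculus along the segment from \<open>p\<close> to \<open>z\<close>.\<close>

lemma hadamard:
  fixes f :: "'e::euclidean_space \<Rightarrow> real"
  assumes f: "smooth_on f (ball p R)" and z: "z \<in> ball p R"
  shows "f z = f p + (\<Sum>i\<in>Basis. ((z - p) \<bullet> i) * ray_mean p 0 (\<lambda>y. frechet_derivative f (at y) i) z)"
proof -
  let ?f' = "\<lambda>x. frechet_derivative f (at x)" and ?c = "\<lambda>t. p + t *\<^sub>R (z - p)"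
  have "((\<lambda>t. ?f' (?c t) (z - p)) has_integral f (?c 1) - f (?c 0)) {0..1}"
  proof (rule fundamental_theorem_of_calculus)
    fix t :: real assume t: "t \<in> {0..1}"
    note f' = smooth_on_has_derivative[OF f segment_in_ball[OF z t]]
    have "(?c has_derivative (\<lambda>s. s *\<^sub>R (z - p))) (at t)"
      by (auto intro!: derivative_eq_intros)
    from has_derivative_compose[OF this f']
    have "((\<lambda>t. f (?c t)) has_derivative (\<lambda>s. ?f' (?c t) (s *\<^sub>R (z - p)))) (at t)" .
    moreover have "?f' (?c t) (s *\<^sub>R (z - p)) = s *\<^sub>R ?f' (?c t) (z - p)" for s
      using f' has_derivative_bounded_linear bounded_linear.linear linear_cmul by blast
    ultimately show "((\<lambda>t. f (?c t)) has_vector_derivative ?f' (?c t) (z - p)) (at t within {0..1})"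
      by (simp add: has_vector_derivative_def has_derivative_at_withinI)
  qed simp
  then have "f z - f p = integral {0..1} (\<lambda>t. ?f' (?c t) (z - p))"
    by (simp add: integral_unique)
  also have "\<dots> = integral {0..1} (\<lambda>t. \<Sum>i\<in>Basis. ((z - p) \<bullet> i) * (t ^ 0 * ?f' (?c t) i))"
  proof (rule integral_cong)
    fix t :: real assume t: "t \<in> {0..1}"
    have l: "linear (?f' (?c t))"
      using smooth_on_has_derivative[OF f segment_in_ball[OF z t]]
        has_derivative_bounded_linear bounded_linear.linear by blast
    have "?f' (?c t) (z - p) = ?f' (?c t) (\<Sum>i\<in>Basis. ((z - p) \<bullet> i) *\<^sub>R i)"
      by (simp only: euclidean_representation)
    also have "\<dots> = (\<Sum>i\<in>Basis. ((z - p) \<bullet> i) * (t ^ 0 * ?f' (?c t) i))"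
      by (simp only: linear_sum[OF l] linear_cmul[OF l]) simp
    finally show "?f' (?c t) (z - p) = (\<Sum>i\<in>Basis. ((z - p) \<bullet> i) * (t ^ 0 * ?f' (?c t) i))" .
  qed
  also have "\<dots> = (\<Sum>i\<in>Basis. ((z - p) \<bullet> i) * ray_mean p 0 (\<lambda>y. ?f' y i) z)"
  proof -
    have "(\<lambda>t. t ^ 0 * ?f' (?c t) i) integrable_on {0..1}" for i
      using smooth_on_directional_derivative[OF f, of i]
      by (intro integrable_on_ray[OF _ z]) (metis Ck_on.simps(1) smooth_on_def)
    then show ?thesis
      unfolding ray_mean_def
      by (subst integral_sum) (auto intro: integrable_on_mult_right simp del: power_0)
  qed
  finally show ?thesis by simp
qed

lemma ray_mean_centre: "ray_mean p 0 f p = f p"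
  by (simp add: ray_mean_def)


section \<open>Smooth functions on a manifold\<close>

locale manifold_context =
  fixes M :: "('a, 'e::euclidean_space) manifold"
  assumes smooth_manifold: "smooth_manifold M"
begin

lemma chart:
  assumes "(U, \<phi>) \<in> atlas M"
  shows "openin (mtop M) U" "U \<subseteq> pts M" "open (\<phi> ` U)" "inj_on \<phi> U"
    and "homeomorphic_map (subtopology (mtop M) U) (top_of_set (\<phi> ` U)) \<phi>"
proof -
  have c: "is_chart (mtop M) (U, \<phi>)"
    using assms smooth_manifold by (auto simp: smooth_manifold_def)
  then show "openin (mtop M) U" "open (\<phi> ` U)"
    and h: "homeomorphic_map (subtopology (mtop M) U) (top_of_set (\<phi> ` U)) \<phi>"
    by (auto simp: is_chart_def)
  then show U: "U \<subseteq> pts M" by (simp add: openin_subset)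
  then show "inj_on \<phi> U"
    using homeomorphic_imp_injective_map[OF h] by (simp add: topspace_subtopology inf_absorb2)
qed

lemma chart_around:
  assumes "x \<in> pts M"
  obtains U \<phi> where "(U, \<phi>) \<in> atlas M" "x \<in> U"
proof -
  have "x \<in> (\<Union>c\<in>atlas M. fst c)" using assms smooth_manifold by (simp add: smooth_manifold_def)
  then show ?thesis using that by force
qed

lemma transition_smooth:
  assumes "(U, \<phi>) \<in> atlas M" "(V, \<psi>) \<in> atlas M"
  shows "smooth_on (\<lambda>z. \<phi> (inv_into V \<psi> z)) (\<psi> ` (V \<inter> U))"
  using assms smooth_manifold unfolding smooth_manifold_def o_def by fast

lemma chart_open_image:
  assumes "(U, \<phi>) \<in> atlas M" "openin (mtop M) W" "W \<subseteq> U"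
  shows "open (\<phi> ` W)"
proof -
  note c = chart[OF assms(1)]
  have "openin (subtopology (mtop M) U) W"
    using assms(2,3) c(1) by (simp add: openin_open_subtopology)
  then have "openin (top_of_set (\<phi> ` U)) (\<phi> ` W)"
    using homeomorphic_imp_open_map[OF c(5)] by (simp add: open_map_def)
  then show ?thesis using c(3) openin_open_trans by blast
qed

lemma chart_open_preimage:
  assumes "(U, \<phi>) \<in> atlas M" "open B"
  shows "openin (mtop M) {y \<in> U. \<phi> y \<in> B}"
proof -
  note c = chart[OF assms(1)]
  have "continuous_map (subtopology (mtop M) U) (top_of_set (\<phi> ` U)) \<phi>"
    using c(5) homeomorphic_imp_continuous_map by blast
  moreover have "openin (top_of_set (\<phi> ` U)) (\<phi> ` U \<inter> B)"
    using assms(2) by (simp add: openin_open_Int)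
  ultimately have "openin (subtopology (mtop M) U)
      {y \<in> topspace (subtopology (mtop M) U). \<phi> y \<in> \<phi> ` U \<inter> B}"
    by (rule openin_continuous_map_preimage)
  moreover have "{y \<in> topspace (subtopology (mtop M) U). \<phi> y \<in> \<phi> ` U \<inter> B} = {y \<in> U. \<phi> y \<in> B}"
    using c(2) by auto
  ultimately show ?thesis using c(1) by (simp add: openin_open_subtopology)
qed

lemma chart_compact_preimage:
  assumes "(U, \<phi>) \<in> atlas M" "compact C" "C \<subseteq> \<phi> ` U"
  shows "closedin (mtop M) {y \<in> U. \<phi> y \<in> C}"
proof -
  note c = chart[OF assms(1)]
  obtain \<gamma> where "homeomorphic_maps (subtopology (mtop M) U) (top_of_set (\<phi> ` U)) \<phi> \<gamma>"
    using c(5) homeomorphic_map_maps by blast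
  then have cont: "continuous_map (top_of_set (\<phi> ` U)) (subtopology (mtop M) U) \<gamma>"
    and inv: "\<And>y. y \<in> U \<Longrightarrow> \<gamma> (\<phi> y) = y"
    using c(2) by (auto simp: homeomorphic_maps_def)
  have "compactin (top_of_set (\<phi> ` U)) C"
    using assms(2,3) by (simp add: compactin_subtopology)
  then have "compactin (subtopology (mtop M) U) (\<gamma> ` C)"
    using cont by (rule image_compactin)
  moreover have "\<gamma> ` C = {y \<in> U. \<phi> y \<in> C}"
    using assms(3) inv by force
  ultimately have "compactin (mtop M) {y \<in> U. \<phi> y \<in> C}"
    by (simp add: compactin_subtopology)
  then show ?thesis
    using smooth_manifold by (simp add: smooth_manifold_def compactin_imp_closedin)
qed


lemma smooth_fun_chart:
  "smooth_fun M f \<Longrightarrow> (U, \<phi>) \<in> atlas M \<Longrightarrow> smooth_on (\<lambda>z. f (inv_into U \<phi> z)) (\<phi> ` U)"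
  by (auto simp: smooth_fun_def o_def)

lemma smooth_funI:
  "(\<And>U \<phi>. (U, \<phi>) \<in> atlas M \<Longrightarrow> smooth_on (\<lambda>z. f (inv_into U \<phi> z)) (\<phi> ` U)) \<Longrightarrow> smooth_fun M f"
  by (auto simp: smooth_fun_def o_def)

lemma smooth_fun_cong:
  assumes "smooth_fun M f" "\<And>x. x \<in> pts M \<Longrightarrow> f x = h x"
  shows "smooth_fun M h"
proof (rule smooth_funI)
  fix U \<phi> assume c: "(U, \<phi>) \<in> atlas M"
  show "smooth_on (\<lambda>z. h (inv_into U \<phi> z)) (\<phi> ` U)"
  proof (rule smooth_on_cong[OF chart(3)[OF c] _ smooth_fun_chart[OF assms(1) c]])
    show "f (inv_into U \<phi> z) = h (inv_into U \<phi> z)" if "z \<in> \<phi> ` U" for z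
      using inv_into_into[OF that] chart(2)[OF c] assms(2) by blast
  qed
qed

lemma smooth_fun_const: "smooth_fun M (\<lambda>x. c)"
  by (rule smooth_funI) (simp add: smooth_on_const chart)

lemma smooth_fun_linear_compose:
  "bounded_linear L \<Longrightarrow> smooth_fun M f \<Longrightarrow> smooth_fun M (\<lambda>x. L (f x))"
  by (rule smooth_funI, rule smooth_on_linear_compose) (auto dest: smooth_fun_chart chart(3))

lemma smooth_fun_add: "smooth_fun M f \<Longrightarrow> smooth_fun M h \<Longrightarrow> smooth_fun M (\<lambda>x. f x + h x)"
  by (rule smooth_funI, rule smooth_on_add) (auto dest: smooth_fun_chart chart(3))

lemma smooth_fun_mult:
  fixes f h :: "'a \<Rightarrow> real"
  shows "smooth_fun M f \<Longrightarrow> smooth_fun M h \<Longrightarrow> smooth_fun M (\<lambda>x. f x * h x)"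
  by (rule smooth_funI, rule smooth_on_mult) (auto dest: smooth_fun_chart chart(3))

lemma smooth_fun_comb:
  fixes f h :: "'a \<Rightarrow> real"
  shows "smooth_fun M f \<Longrightarrow> smooth_fun M h \<Longrightarrow> smooth_fun M (\<lambda>x. a * f x + b * h x)"
  by (intro smooth_fun_add smooth_fun_mult smooth_fun_const)

lemma smooth_fun_scale:
  fixes f :: "'a \<Rightarrow> real"
  shows "smooth_fun M f \<Longrightarrow> smooth_fun M (\<lambda>x. c * f x)"
  by (intro smooth_fun_mult smooth_fun_const)

lemma smooth_fun_minus:
  fixes f :: "'a \<Rightarrow> real"
  shows "smooth_fun M f \<Longrightarrow> smooth_fun M (\<lambda>x. - f x)"
  using smooth_fun_scale[of f "-1"] by simp

lemma smooth_fun_diff: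
  fixes f h :: "'a \<Rightarrow> real"
  shows "smooth_fun M f \<Longrightarrow> smooth_fun M h \<Longrightarrow> smooth_fun M (\<lambda>x. f x - h x)"
  using smooth_fun_comb[of f h 1 "-1"] by simp

lemma smooth_fun_Complex:
  assumes "smooth_fun M f" "smooth_fun M h"
  shows "smooth_fun M (\<lambda>x. Complex (f x) (h x))"
proof -
  have "smooth_fun M (\<lambda>x. complex_of_real (f x) + h x *\<^sub>R \<i>)"
    by (intro smooth_fun_add smooth_fun_linear_compose[OF bounded_linear_of_real assms(1)]
        smooth_fun_linear_compose[OF bounded_linear_scaleR_left assms(2)])
  then show ?thesis by (simp add: Complex_eq scaleR_conv_of_real mult.commute)
qed

text \<open>In a second chart with domain \<open>V\<close>, smoothness is checked on two open sets that cover \<open>V\<close>: the part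
  lying over the ball, where the transition map is available, and the complement of the closed set
  over \<open>cball p r\<close>. That this set is closed in the manifold uses that the manifold is Hausdorff.\<close>

lemma smooth_fun_extend_by_zero:
  fixes F :: "'e \<Rightarrow> real"
  assumes c: "(U, \<phi>) \<in> atlas M" and B: "ball p R \<subseteq> \<phi> ` U" and "r < R"
    and F: "smooth_on F (ball p R)" "\<And>z. z \<notin> cball p r \<Longrightarrow> F z = 0"
  shows "smooth_fun M (\<lambda>y. if y \<in> U then F (\<phi> y) else 0)" (is "smooth_fun M ?f")
proof (rule smooth_funI)
  fix V \<psi> assume d: "(V, \<psi>) \<in> atlas M"
  let ?W = "{y \<in> U. \<phi> y \<in> ball p R}" and ?K = "{y \<in> U. \<phi> y \<in> cball p r}"
  have sub: "cball p r \<subseteq> ball p R" using \<open>r < R\<close> by auto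
  have W: "openin (mtop M) ?W" by (rule chart_open_preimage[OF c open_ball])
  have K: "closedin (mtop M) ?K"
    using sub B by (intro chart_compact_preimage[OF c compact_cball]) auto
  have VW: "open (\<psi> ` (V \<inter> ?W))"
    by (intro chart_open_image[OF d] openin_Int chart(1)[OF d] W) auto
  have VK: "open (\<psi> ` (V - ?K))"
    by (intro chart_open_image[OF d] openin_diff chart(1)[OF d] K) auto
  have inv: "inv_into V \<psi> (\<psi> y) = y" if "y \<in> V" for y
    using that chart(4)[OF d] by simp
  have near: "smooth_on (\<lambda>z. ?f (inv_into V \<psi> z)) (\<psi> ` (V \<inter> ?W))"
  proof (rule smooth_on_cong[OF VW])
    show "smooth_on (\<lambda>z. F (\<phi> (inv_into V \<psi> z))) (\<psi> ` (V \<inter> ?W))"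
    proof (rule smooth_on_compose[OF VW open_ball _ F(1)])
      show "smooth_on (\<lambda>z. \<phi> (inv_into V \<psi> z)) (\<psi> ` (V \<inter> ?W))"
        by (rule smooth_on_subset[OF transition_smooth[OF c d]]) auto
    qed (use inv in auto)
  qed (use inv in auto)
  have away: "smooth_on (\<lambda>z. ?f (inv_into V \<psi> z)) (\<psi> ` (V - ?K))"
  proof (rule smooth_on_cong[OF VK])
    show "smooth_on (\<lambda>z. 0 :: real) (\<psi> ` (V - ?K))" by (rule smooth_on_const[OF VK])
    fix z assume "z \<in> \<psi> ` (V - ?K)"
    then obtain y where "y \<in> V" "y \<notin> ?K" "z = \<psi> y" by blast
    then show "0 = ?f (inv_into V \<psi> z)" using inv F(2)[of "\<phi> y"] by auto
  qed
  have "\<psi> ` (V \<inter> ?W) \<union> \<psi> ` (V - ?K) = \<psi> ` V"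
  proof -
    have "?K \<subseteq> ?W" using sub by blast
    then have "(V \<inter> ?W) \<union> (V - ?K) = V" by blast
    then show ?thesis by (simp only: image_Un[symmetric])
  qed
  then show "smooth_on (\<lambda>z. ?f (inv_into V \<psi> z)) (\<psi> ` V)"
    using smooth_on_Un[OF VW VK near away] by (simp only:)
qed


section \<open>Tangent vectors as derivations\<close>

lemma tangent_comb:
  "u \<in> tangent_space M x \<Longrightarrow> smooth_fun M f \<Longrightarrow> smooth_fun M h \<Longrightarrow>
    u (\<lambda>y. a * f y + b * h y) = a * u f + b * u h"
  by (auto simp: tangent_space_def)

lemma tangent_mult:
  "u \<in> tangent_space M x \<Longrightarrow> smooth_fun M f \<Longrightarrow> smooth_fun M h \<Longrightarrow>
    u (\<lambda>y. f y * h y) = u f * h x + f x * u h"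
  by (auto simp: tangent_space_def)

lemma tangent_not_smooth: "u \<in> tangent_space M x \<Longrightarrow> \<not> smooth_fun M f \<Longrightarrow> u f = 0"
  by (auto simp: tangent_space_def)

lemma tangent_const:
  assumes u: "u \<in> tangent_space M x"
  shows "u (\<lambda>y. c) = 0"
proof -
  have "u (\<lambda>y. 1) = 0"
    using tangent_mult[OF u smooth_fun_const smooth_fun_const, of 1 1] by simp
  then show ?thesis
    using tangent_comb[OF u smooth_fun_const smooth_fun_const, of c 1 0 1] by simp
qed

lemma tangent_add:
  "u \<in> tangent_space M x \<Longrightarrow> smooth_fun M f \<Longrightarrow> smooth_fun M h \<Longrightarrow>
    u (\<lambda>y. f y + h y) = u f + u h"
  using tangent_comb[of u x f h 1 1] by simp

lemma tangent_diff:
  "u \<in> tangent_space M x \<Longrightarrow> smooth_fun M f \<Longrightarrow> smooth_fun M h \<Longrightarrow>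
    u (\<lambda>y. f y - h y) = u f - u h"
  using tangent_comb[of u x f h 1 "-1"] by simp

lemma tangent_scale:
  "u \<in> tangent_space M x \<Longrightarrow> smooth_fun M f \<Longrightarrow> u (\<lambda>y. c * f y) = c * u f"
  using tangent_comb[of u x f f c 0] by simp

lemma tangent_minus:
  "u \<in> tangent_space M x \<Longrightarrow> smooth_fun M f \<Longrightarrow> u (\<lambda>y. - f y) = - u f"
  using tangent_scale[of u x f "-1"] by simp

lemma tangent_sum:
  assumes u: "u \<in> tangent_space M x" and f: "\<And>i. i \<in> I \<Longrightarrow> smooth_fun M (f i)"
  shows "u (\<lambda>y. \<Sum>i\<in>I. f i y) = (\<Sum>i\<in>I. u (f i))"
proof -
  have "smooth_fun M (\<lambda>y. \<Sum>i\<in>I. f i y) \<and> u (\<lambda>y. \<Sum>i\<in>I. f i y) = (\<Sum>i\<in>I. u (f i))"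
    using f
    by (induction I rule: infinite_finite_induct)
       (simp_all add: smooth_fun_const tangent_const[OF u] smooth_fun_add tangent_add[OF u])
  then show ?thesis ..
qed

text \<open>The indicator function \<open>c\<close> of the complement of the manifold is smooth, vanishes on the manifold, and
  satisfies \<open>k = k c\<close> for every function \<open>k\<close> that is zero on the manifold; by the product rule a
  derivation kills such a \<open>k\<close>.\<close>

lemma tangent_cong:
  assumes u: "u \<in> tangent_space M x" and x: "x \<in> pts M"
    and f: "smooth_fun M f" and eq: "\<And>y. y \<in> pts M \<Longrightarrow> f y = h y"
  shows "u f = u h"
proof -
  let ?c = "\<lambda>y. if y \<in> pts M then 0 else (1::real)"
  have h: "smooth_fun M h" by (rule smooth_fun_cong[OF f eq])
  have c: "smooth_fun M ?c" by (rule smooth_fun_cong[OF smooth_fun_const[of 0]]) simp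
  have "u (\<lambda>y. f y - h y) = u (\<lambda>y. (f y - h y) * ?c y)"
    by (rule arg_cong[of _ _ u]) (auto simp: eq)
  also have "\<dots> = 0"
    using x by (simp only: tangent_mult[OF u smooth_fun_diff[OF f h] c]) (simp add: eq)
  finally show ?thesis using tangent_diff[OF u f h] by simp
qed

lemma tangent_space_comb:
  assumes "u \<in> tangent_space M x" "w \<in> tangent_space M x"
  shows "tv_comb a u b w \<in> tangent_space M x"
  using assms by (auto simp: tangent_space_def tv_comb_def algebra_simps)

lemma vector_field_tangent: "X \<in> vector_fields M \<Longrightarrow> x \<in> pts M \<Longrightarrow> X x \<in> tangent_space M x"
  by (simp add: vector_fields_def)

lemma vector_field_smooth: "X \<in> vector_fields M \<Longrightarrow> smooth_fun M f \<Longrightarrow> smooth_fun M (\<lambda>x. X x f)"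
  by (simp add: vector_fields_def)

text \<open>Near \<open>x\<close>, Hadamard's lemma writes \<open>f - f x\<close> as a sum of products of two functions, the first of which,
  a coordinate, vanishes at \<open>x\<close>. After multiplication with a bump function these factors become
  globally smooth, and the product rule shows that \<open>u\<close> is the derivative in the direction \<open>w\<close> whose
  components are the values of \<open>u\<close> on the cut-off coordinates.\<close>

lemma tangent_extends_to_vector_field:
  assumes x: "x \<in> pts M" and u: "u \<in> tangent_space M x"
  obtains X where "X \<in> vector_fields M" "X x = u"
proof -
  obtain U \<phi> where c: "(U, \<phi>) \<in> atlas M" and xU: "x \<in> U" using chart_around[OF x] .
  define p where "p = \<phi> x"
  have "p \<in> \<phi> ` U" using xU p_def by simp
  then obtain R where R: "R > 0" "ball p R \<subseteq> \<phi> ` U"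
    using chart(3)[OF c] open_contains_ball by blast
  obtain \<rho> :: "'e \<Rightarrow> real" where \<rho>: "smooth_on \<rho> UNIV" "\<rho> p = 1"
      "\<And>z. z \<notin> cball p (R / 2) \<Longrightarrow> \<rho> z = 0"
    using exists_bump[of "R / 2" p] R(1) by auto
  define cut where "cut F = (\<lambda>y. if y \<in> U then \<rho> (\<phi> y) * F (\<phi> y) else 0)" for F
  have cut_smooth: "smooth_fun M (cut F)" if "smooth_on F (ball p R)" for F
    unfolding cut_def
  proof (rule smooth_fun_extend_by_zero[OF c R(2), where r = "R / 2" and F = "\<lambda>z. \<rho> z * F z"])
    show "R / 2 < R" using R(1) by simp
    show "\<rho> z * F z = 0" if "z \<notin> cball p (R / 2)" for z
      using \<rho>(3)[OF that] by simp
    show "smooth_on (\<lambda>z. \<rho> z * F z) (ball p R)"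
      using that smooth_on_subset[OF \<rho>(1)] by (intro smooth_on_mult) auto
  qed
  have cut_x: "cut F x = F p" for F
    using xU \<rho>(2) by (simp add: cut_def p_def)
  let ?local = "\<lambda>f z. f (inv_into U \<phi> z)"
  have local_smooth: "smooth_on (?local f) (ball p R)" if "smooth_fun M f" for f :: "'a \<Rightarrow> real"
    using smooth_on_subset[OF smooth_fun_chart[OF that c] R(2)] .
  have inv: "inv_into U \<phi> (\<phi> y) = y" if "y \<in> U" for y
    using that chart(4)[OF c] by simp
  define \<xi> where "\<xi> i = cut (\<lambda>z. (z - p) \<bullet> i)" for i
  have \<xi>: "smooth_fun M (\<xi> i)" "\<xi> i x = 0" for i
  proof -
    have "Ck_on k (\<lambda>z. z + (- p)) (ball p R)" for k
      by (intro Ck_on_add Ck_on_ident Ck_on_const open_ball)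
    then have "smooth_on (\<lambda>z. (z - p) \<bullet> i) (ball p R)"
      unfolding smooth_on_def
      by (intro allI Ck_on_linear_compose[OF bounded_linear_inner_left open_ball]) simp
    then show "smooth_fun M (\<xi> i)" unfolding \<xi>_def by (rule cut_smooth)
    show "\<xi> i x = 0" by (simp add: \<xi>_def cut_x)
  qed
  define w where "w = (\<Sum>i\<in>Basis. u (\<xi> i) *\<^sub>R i)"
  have u_eq: "u f = frechet_derivative (?local f) (at p) w" if f: "smooth_fun M f" for f
  proof -
    let ?f' = "\<lambda>z. frechet_derivative (?local f) (at z)"
    define \<eta> where "\<eta> i = cut (ray_mean p 0 (\<lambda>z. ?f' z i))" for i
    have \<eta>: "smooth_fun M (\<eta> i)" "\<eta> i x = ?f' p i" for i
    proof -
      show "smooth_fun M (\<eta> i)"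
        unfolding \<eta>_def
        using smooth_on_directional_derivative[OF local_smooth[OF f], of i]
        by (intro cut_smooth) (simp add: smooth_on_def Ck_on_ray_mean)
      show "\<eta> i x = ?f' p i" by (simp add: \<eta>_def cut_x ray_mean_centre)
    qed
    let ?\<chi> = "cut (\<lambda>z. 1)" and ?g = "\<lambda>y. f y - f x"
    have \<chi>: "smooth_fun M ?\<chi>" "?\<chi> x = 1"
      by (intro cut_smooth) (simp_all add: smooth_on_const cut_x)
    have g: "smooth_fun M ?g" by (rule smooth_fun_diff[OF f smooth_fun_const])
    \<comment> \<open>One bump factor for each of the two factors in Hadamard's products.\<close>
    have "?\<chi> y * (?\<chi> y * ?g y) = (\<Sum>i\<in>Basis. \<xi> i y * \<eta> i y)" for y
    proof (cases "y \<in> U \<and> \<phi> y \<in> ball p R")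
      case True
      then have "f y - f x =
          (\<Sum>i\<in>Basis. ((\<phi> y - p) \<bullet> i) * ray_mean p 0 (\<lambda>z. ?f' z i) (\<phi> y))"
        using hadamard[OF local_smooth[OF f], of "\<phi> y"] inv xU by (simp add: p_def)
      then show ?thesis
        using True by (simp add: cut_def \<xi>_def \<eta>_def sum_distrib_left mult_ac)
    next
      case False
      then have "y \<notin> U \<or> \<rho> (\<phi> y) = 0" using \<rho>(3)[of "\<phi> y"] R(1) by auto
      then show ?thesis by (auto simp: cut_def \<xi>_def)
    qed
    then have "u (\<lambda>y. ?\<chi> y * (?\<chi> y * ?g y)) = u (\<lambda>y. \<Sum>i\<in>Basis. \<xi> i y * \<eta> i y)"
      by (intro arg_cong[of _ _ u] ext)
    moreover have "u (\<lambda>y. ?\<chi> y * (?\<chi> y * ?g y)) = u f"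
      by (simp only: tangent_mult[OF u \<chi>(1) smooth_fun_mult[OF \<chi>(1) g]] tangent_mult[OF u \<chi>(1) g]
          tangent_diff[OF u f smooth_fun_const] tangent_const[OF u] \<chi>(2)) simp
    moreover have "u (\<lambda>y. \<Sum>i\<in>Basis. \<xi> i y * \<eta> i y) = (\<Sum>i\<in>Basis. u (\<xi> i) * ?f' p i)"
      by (simp add: tangent_sum[OF u] smooth_fun_mult \<xi> \<eta> tangent_mult[OF u])
    moreover have "linear (?f' p)"
      using smooth_on_has_derivative[OF local_smooth[OF f], of p] R(1)
        has_derivative_bounded_linear bounded_linear.linear by (metis centre_in_ball)
    ultimately show ?thesis
      by (simp add: w_def linear_sum linear_cmul)
  qed
  define X :: "'a vfield" where "X y f = (if smooth_fun M f
      then cut (\<lambda>z. frechet_derivative (?local f) (at z) w) y else 0)" for y f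
  have has_derivative_local: "(?local f has_derivative frechet_derivative (?local f) (at (\<phi> y))) (at (\<phi> y))"
    if "smooth_fun M f" "y \<in> U" for f :: "'a \<Rightarrow> real" and y
    using smooth_on_has_derivative[OF smooth_fun_chart[OF that(1) c]] that(2) by simp
  have "X \<in> vector_fields M"
    unfolding vector_fields_def
  proof (intro CollectI conjI ballI allI impI)
    show "smooth_fun M (\<lambda>y. X y f)" if "smooth_fun M f" for f
      using cut_smooth[OF smooth_on_directional_derivative[OF local_smooth[OF that]]] that
      by (simp add: X_def)
    fix y
    show "X y \<in> tangent_space M y"
      unfolding tangent_space_def
    proof (intro CollectI conjI allI impI)
      show "X y f = 0" if "\<not> smooth_fun M f" for f using that by (simp add: X_def)
    next
      fix f h :: "'a \<Rightarrow> real" and a b assume fh: "smooth_fun M f" "smooth_fun M h"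
      have "frechet_derivative (?local (\<lambda>y. a * f y + b * h y)) (at (\<phi> y)) w =
          a * frechet_derivative (?local f) (at (\<phi> y)) w + b * frechet_derivative (?local h) (at (\<phi> y)) w"
        if "y \<in> U"
        by (rule fun_cong[OF frechet_derivative_at[OF has_derivative_add[OF
              has_derivative_mult_right[OF has_derivative_local[OF fh(1) that]]
              has_derivative_mult_right[OF has_derivative_local[OF fh(2) that]]], symmetric]])
      then show "X y (\<lambda>y. a * f y + b * h y) = a * X y f + b * X y h"
        by (simp add: X_def fh smooth_fun_comb cut_def algebra_simps)
    next
      fix f h :: "'a \<Rightarrow> real" assume fh: "smooth_fun M f" "smooth_fun M h"
      have "frechet_derivative (?local (\<lambda>y. f y * h y)) (at (\<phi> y)) w =
          ?local f (\<phi> y) * frechet_derivative (?local h) (at (\<phi> y)) w +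
          frechet_derivative (?local f) (at (\<phi> y)) w * ?local h (\<phi> y)"
        if "y \<in> U"
        by (rule fun_cong[OF frechet_derivative_at[OF has_derivative_mult[OF
              has_derivative_local[OF fh(1) that] has_derivative_local[OF fh(2) that]], symmetric]])
      then show "X y (\<lambda>y. f y * h y) = X y f * h y + f y * X y h"
        by (simp add: X_def fh smooth_fun_mult cut_def inv algebra_simps)
    qed
  qed
  moreover have "X x = u"
    by (rule ext) (simp add: X_def cut_x u_eq tangent_not_smooth[OF u])
  ultimately show ?thesis by (rule that)
qed

end


lemma tv_minus_conv_comb: "tv_minus u = tv_comb (-1) u 0 u"
  by (simp add: tv_minus_def tv_comb_def)

context manifold_context
begin

section \<open>Lie brackets of vector fields\<close>

lemma lie_bracket_vector_field:
  assumes X: "X \<in> vector_fields M" and Y: "Y \<in> vector_fields M"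
  shows "lie_bracket M X Y \<in> vector_fields M"
  unfolding vector_fields_def
proof (intro CollectI conjI ballI allI impI)
  note sm = vector_field_smooth[OF X] vector_field_smooth[OF Y]
  show "smooth_fun M (\<lambda>x. lie_bracket M X Y x f)" if "smooth_fun M f" for f
    using that by (simp add: lie_bracket_def smooth_fun_diff sm)
  fix x assume x: "x \<in> pts M"
  note Xx = vector_field_tangent[OF X x] and Yx = vector_field_tangent[OF Y x]
  show "lie_bracket M X Y x \<in> tangent_space M x"
    unfolding tangent_space_def
  proof (intro CollectI conjI allI impI)
    show "lie_bracket M X Y x f = 0" if "\<not> smooth_fun M f" for f
      using that by (simp add: lie_bracket_def)
  next
    fix f h :: "'a \<Rightarrow> real" and a b assume fh: "smooth_fun M f" "smooth_fun M h"
    have comb: "W (\<lambda>y. Z y (\<lambda>z. a * f z + b * h z)) = a * W (\<lambda>y. Z y f) + b * W (\<lambda>y. Z y h)"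
      if W: "W \<in> tangent_space M x" and Z: "Z \<in> vector_fields M" for W and Z :: "'a vfield"
    proof -
      have "W (\<lambda>y. Z y (\<lambda>z. a * f z + b * h z)) = W (\<lambda>y. a * Z y f + b * Z y h)"
        by (rule tangent_cong[OF W x vector_field_smooth[OF Z smooth_fun_comb[OF fh]]])
           (rule tangent_comb[OF vector_field_tangent[OF Z] fh])
      then show ?thesis
        by (simp add: tangent_comb[OF W] fh vector_field_smooth[OF Z])
    qed
    show "lie_bracket M X Y x (\<lambda>y. a * f y + b * h y) =
        a * lie_bracket M X Y x f + b * lie_bracket M X Y x h"
      by (simp add: lie_bracket_def fh smooth_fun_comb comb[OF Xx Y] comb[OF Yx X] algebra_simps)
  next
    fix f h :: "'a \<Rightarrow> real" assume fh: "smooth_fun M f" "smooth_fun M h"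
    have prod: "W (\<lambda>y. Z y (\<lambda>z. f z * h z)) =
        (W (\<lambda>y. Z y f) * h x + Z x f * W h) + (W f * Z x h + f x * W (\<lambda>y. Z y h))"
      if W: "W \<in> tangent_space M x" and Z: "Z \<in> vector_fields M" for W and Z :: "'a vfield"
    proof -
      have "W (\<lambda>y. Z y (\<lambda>z. f z * h z)) = W (\<lambda>y. Z y f * h y + f y * Z y h)"
        by (rule tangent_cong[OF W x vector_field_smooth[OF Z smooth_fun_mult[OF fh]]])
           (rule tangent_mult[OF vector_field_tangent[OF Z] fh])
      then show ?thesis
        by (simp add: tangent_add[OF W] tangent_mult[OF W] fh smooth_fun_mult vector_field_smooth[OF Z])
    qed
    show "lie_bracket M X Y x (\<lambda>y. f y * h y) =
        lie_bracket M X Y x f * h x + f x * lie_bracket M X Y x h"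
      by (simp add: lie_bracket_def fh smooth_fun_mult prod[OF Xx Y] prod[OF Yx X] algebra_simps)
  qed
qed

lemma jacobi:
  assumes "X \<in> vector_fields M" "Y \<in> vector_fields M" "Z \<in> vector_fields M" and x: "x \<in> pts M"
  shows "tv_comb 1 (lie_bracket M (lie_bracket M X Y) Z x) 1 (lie_bracket M (lie_bracket M Y Z) X x)
    = lie_bracket M (lie_bracket M X Z) Y x"
proof (rule ext)
  fix f
  note VF = assms(1-3)
  show "tv_comb 1 (lie_bracket M (lie_bracket M X Y) Z x) 1 (lie_bracket M (lie_bracket M Y Z) X x) f
      = lie_bracket M (lie_bracket M X Z) Y x f"
  proof (cases "smooth_fun M f")
    case True
    then show ?thesis
      by (simp add: tv_comb_def lie_bracket_def VF[THEN vector_field_smooth]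
          VF[THEN vector_field_tangent, OF x, THEN tangent_diff])
  qed (simp add: tv_comb_def lie_bracket_def)
qed

section \<open>Forms of low degree\<close>

text \<open>Complex forms are handled through their real and imaginary parts. The alternating condition
  in degree two appears as skewness, which is equivalent to it over the reals.\<close>

definition real_one_form :: "('a \<Rightarrow> 'a tvec \<Rightarrow> real) \<Rightarrow> bool" where
  "real_one_form \<beta> \<longleftrightarrow>
     (\<forall>x\<in>pts M. \<forall>u\<in>tangent_space M x. \<forall>w\<in>tangent_space M x. \<forall>a c.
        \<beta> x (tv_comb a u c w) = a * \<beta> x u + c * \<beta> x w) \<and>
     (\<forall>X\<in>vector_fields M. smooth_fun M (\<lambda>x. \<beta> x (X x)))"

definition real_two_form :: "('a \<Rightarrow> 'a tvec \<Rightarrow> 'a tvec \<Rightarrow> real) \<Rightarrow> bool" where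
  "real_two_form b \<longleftrightarrow>
     (\<forall>x\<in>pts M. \<forall>u\<in>tangent_space M x. \<forall>w\<in>tangent_space M x. \<forall>z\<in>tangent_space M x. \<forall>a c.
        b x (tv_comb a u c w) z = a * b x u z + c * b x w z) \<and>
     (\<forall>x\<in>pts M. \<forall>u\<in>tangent_space M x. \<forall>w\<in>tangent_space M x. b x u w = - b x w u) \<and>
     (\<forall>X\<in>vector_fields M. \<forall>Y\<in>vector_fields M. smooth_fun M (\<lambda>x. b x (X x) (Y x)))"

lemma real_one_form_scale: "real_one_form b \<Longrightarrow> real_one_form (\<lambda>x u. p * b x u)"
  unfolding real_one_form_def by (auto simp: algebra_simps smooth_fun_scale)

lemma real_two_form_skew:
  "real_two_form b \<Longrightarrow> x \<in> pts M \<Longrightarrow> u \<in> tangent_space M x \<Longrightarrow> w \<in> tangent_space M x \<Longrightarrow>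
    b x u w = - b x w u"
  unfolding real_two_form_def by blast

lemma real_two_form_left:
  "real_two_form b \<Longrightarrow> x \<in> pts M \<Longrightarrow> u \<in> tangent_space M x \<Longrightarrow> w \<in> tangent_space M x \<Longrightarrow>
    z \<in> tangent_space M x \<Longrightarrow> b x (tv_comb a u c w) z = a * b x u z + c * b x w z"
  unfolding real_two_form_def by blast

lemma real_two_form_right:
  assumes b: "real_two_form b" "x \<in> pts M"
    and t: "u \<in> tangent_space M x" "w \<in> tangent_space M x" "z \<in> tangent_space M x"
  shows "b x z (tv_comb a u c w) = a * b x z u + c * b x z w"
  using real_two_form_left[OF b t, of a c] real_two_form_skew[OF b t(3) tangent_space_comb[OF t(1,2)], of a c]
    real_two_form_skew[OF b t(3,1)] real_two_form_skew[OF b t(3,2)] by simp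

lemma real_two_form_smooth:
  "real_two_form b \<Longrightarrow> X \<in> vector_fields M \<Longrightarrow> Y \<in> vector_fields M \<Longrightarrow>
    smooth_fun M (\<lambda>x. b x (X x) (Y x))"
  unfolding real_two_form_def by blast

lemma real_two_form_comb:
  assumes "real_two_form b" "real_two_form c"
  shows "real_two_form (\<lambda>x u w. p * b x u w + q * c x u w)"
  unfolding real_two_form_def
proof (intro conjI ballI allI)
  fix x u w assume *: "x \<in> pts M" "u \<in> tangent_space M x" "w \<in> tangent_space M x"
  show "p * b x u w + q * c x u w = - (p * b x w u + q * c x w u)"
    using real_two_form_skew[OF assms(1) *] real_two_form_skew[OF assms(2) *] by simp
  fix z r s assume "z \<in> tangent_space M x"
  then show "p * b x (tv_comb r u s w) z + q * c x (tv_comb r u s w) z =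
      r * (p * b x u z + q * c x u z) + s * (p * b x w z + q * c x w z)"
    using * by (simp add: assms real_two_form_left algebra_simps)
next
  fix X Y assume "X \<in> vector_fields M" "Y \<in> vector_fields M"
  then show "smooth_fun M (\<lambda>x. p * b x (X x) (Y x) + q * c x (X x) (Y x))"
    using smooth_fun_comb[OF real_two_form_smooth[OF assms(1)] real_two_form_smooth[OF assms(2)]]
    by blast
qed

lemma real_two_form_scale:
  "real_two_form b \<Longrightarrow> real_two_form (\<lambda>x u w. p * b x u w)"
  using real_two_form_comb[of b b p 0] by simp

definition one_form :: "('a \<Rightarrow> 'a tvec \<Rightarrow> real) \<Rightarrow> ('a \<Rightarrow> 'a tvec \<Rightarrow> real) \<Rightarrow> 'a cform" where
  "one_form \<beta> \<gamma> = (\<lambda>x us. Complex (\<beta> x (us ! 0)) (\<gamma> x (us ! 0)))"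

definition two_form ::
  "('a \<Rightarrow> 'a tvec \<Rightarrow> 'a tvec \<Rightarrow> real) \<Rightarrow> ('a \<Rightarrow> 'a tvec \<Rightarrow> 'a tvec \<Rightarrow> real) \<Rightarrow> 'a cform" where
  "two_form b c = (\<lambda>x us. Complex (b x (us ! 0) (us ! 1)) (c x (us ! 0) (us ! 1)))"

lemma complex_form_one_form:
  assumes "real_one_form \<beta>" "real_one_form \<gamma>"
  shows "complex_form M 1 (one_form \<beta> \<gamma>)"
  unfolding complex_form_def
proof (intro conjI ballI allI impI)
  fix x us i u w a b
  assume "x \<in> pts M" "length us = 1 \<and> set us \<subseteq> tangent_space M x" "i < (1::nat)"
    "u \<in> tangent_space M x" "w \<in> tangent_space M x"
  then show "one_form \<beta> \<gamma> x (us[i := tv_comb a u b w]) =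
      complex_of_real a * one_form \<beta> \<gamma> x (us[i := u]) + complex_of_real b * one_form \<beta> \<gamma> x (us[i := w])"
    using assms by (simp add: one_form_def real_one_form_def complex_eq_iff)
next
  fix Xs assume Xs: "length Xs = 1 \<and> set Xs \<subseteq> vector_fields M"
  then obtain X where "Xs = [X]" "X \<in> vector_fields M" by (auto simp: length_Suc_conv)
  then show "smooth_fun M (\<lambda>x. one_form \<beta> \<gamma> x (map (\<lambda>X. X x) Xs))"
    using assms by (simp add: one_form_def real_one_form_def smooth_fun_Complex)
qed auto

lemma complex_form_two_form:
  assumes b: "real_two_form b" and c: "real_two_form c"
  shows "complex_form M 2 (two_form b c)"
  unfolding complex_form_def
proof (intro conjI ballI allI impI)
  fix x us i u w r s
  assume *: "x \<in> pts M" "length us = 2 \<and> set us \<subseteq> tangent_space M x" "i < (2::nat)"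
    "u \<in> tangent_space M x" "w \<in> tangent_space M x"
  from *(2) obtain u0 u1 where us: "us = [u0, u1]" "u0 \<in> tangent_space M x" "u1 \<in> tangent_space M x"
    by (auto simp: length_Suc_conv eval_nat_numeral)
  consider "i = 0" | "i = 1" using *(3) by linarith
  then show "two_form b c x (us[i := tv_comb r u s w]) =
      complex_of_real r * two_form b c x (us[i := u]) + complex_of_real s * two_form b c x (us[i := w])"
    by cases (simp_all add: us two_form_def complex_eq_iff real_two_form_left[OF b *(1)] *(4,5)
        real_two_form_left[OF c *(1)] real_two_form_right[OF b *(1)] real_two_form_right[OF c *(1)])
next
  fix x us i j
  assume *: "x \<in> pts M" "length us = 2 \<and> set us \<subseteq> tangent_space M x"
    "i < j \<and> j < (2::nat) \<and> us ! i = us ! j"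
  from *(2) obtain u0 u1 where us: "us = [u0, u1]" "u0 \<in> tangent_space M x" "u1 \<in> tangent_space M x"
    by (auto simp: length_Suc_conv eval_nat_numeral)
  have "i = 0" "j = 1" using *(3) by linarith+
  with *(3) have "u1 = u0" by (simp add: us(1))
  then show "two_form b c x us = 0"
    using real_two_form_skew[OF b *(1) us(2,2)] real_two_form_skew[OF c *(1) us(2,2)]
    by (simp add: us(1) two_form_def complex_eq_iff)
next
  fix Xs assume Xs: "length Xs = 2 \<and> set Xs \<subseteq> vector_fields M"
  then obtain X Y where "Xs = [X, Y]" "X \<in> vector_fields M" "Y \<in> vector_fields M"
    by (auto simp: length_Suc_conv eval_nat_numeral)
  then show "smooth_fun M (\<lambda>x. two_form b c x (map (\<lambda>X. X x) Xs))"
    by (simp add: two_form_def smooth_fun_Complex real_two_form_smooth b c)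
qed

text \<open>Real versions of the exterior derivative formula in degrees one and two.\<close>

definition d_one :: "('a \<Rightarrow> 'a tvec \<Rightarrow> real) \<Rightarrow> 'a vfield \<Rightarrow> 'a vfield \<Rightarrow> 'a \<Rightarrow> real" where
  "d_one \<beta> X Y x = X x (\<lambda>y. \<beta> y (Y y)) - Y x (\<lambda>y. \<beta> y (X y)) - \<beta> x (lie_bracket M X Y x)"

definition d_two ::
  "('a \<Rightarrow> 'a tvec \<Rightarrow> 'a tvec \<Rightarrow> real) \<Rightarrow> 'a vfield \<Rightarrow> 'a vfield \<Rightarrow> 'a vfield \<Rightarrow> 'a \<Rightarrow> real" where
  "d_two b X Y Z x =
     X x (\<lambda>y. b y (Y y) (Z y)) - Y x (\<lambda>y. b y (X y) (Z y)) + Z x (\<lambda>y. b y (X y) (Y y))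
     - b x (lie_bracket M X Y x) (Z x) + b x (lie_bracket M X Z x) (Y x)
     - b x (lie_bracket M Y Z x) (X x)"

lemma ext_deriv_formula_one_form:
  "ext_deriv_formula M (one_form \<beta> \<gamma>) [X, Y] x = Complex (d_one \<beta> X Y x) (d_one \<gamma> X Y x)"
  by (simp add: ext_deriv_formula_def omit_def one_form_def d_one_def tv_complex_def complex_eq_iff)

lemma ext_deriv_formula_two_form:
  "ext_deriv_formula M (two_form b c) [X, Y, Z] x = Complex (d_two b X Y Z x) (d_two c X Y Z x)"
  by (simp add: ext_deriv_formula_def omit_def two_form_def d_two_def tv_complex_def complex_eq_iff)

lemma d_one_scale:
  assumes "real_one_form \<beta>" "X \<in> vector_fields M" "Y \<in> vector_fields M" "x \<in> pts M"
  shows "d_one (\<lambda>x u. p * \<beta> x u) X Y x = p * d_one \<beta> X Y x"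
proof -
  have "smooth_fun M (\<lambda>y. \<beta> y (W y))" if "W \<in> vector_fields M" for W
    using assms(1) that by (simp add: real_one_form_def)
  note scale = tangent_scale[OF vector_field_tangent[OF _ assms(4)] this]
  show ?thesis
    by (simp add: d_one_def scale[OF assms(2,3)] scale[OF assms(3,2)] algebra_simps)
qed

lemma d_two_scale:
  assumes "real_two_form b" "X \<in> vector_fields M" "Y \<in> vector_fields M" "Z \<in> vector_fields M"
    "x \<in> pts M"
  shows "d_two (\<lambda>x u w. p * b x u w) X Y Z x = p * d_two b X Y Z x"
proof -
  note scale = tangent_scale[OF vector_field_tangent[OF _ assms(5)] real_two_form_smooth[OF assms(1)]]
  show ?thesis
    by (simp add: d_two_def scale[OF assms(2,3,4)] scale[OF assms(3,2,4)] scale[OF assms(4,2,3)]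
        algebra_simps)
qed

text \<open>This is \<open>d (d \<beta>) = 0\<close>. The second derivatives of functions \<open>\<beta>(X)\<close> cancel against the terms from the
  brackets, and what remains is \<open>\<beta>\<close> applied to the Jacobi identity.\<close>

lemma d_two_d_one:
  assumes \<beta>: "real_one_form \<beta>"
    and d: "\<And>X Y x. X \<in> vector_fields M \<Longrightarrow> Y \<in> vector_fields M \<Longrightarrow> x \<in> pts M \<Longrightarrow>
      b x (X x) (Y x) = d_one \<beta> X Y x"
    and X: "X \<in> vector_fields M" and Y: "Y \<in> vector_fields M" and Z: "Z \<in> vector_fields M"
    and x: "x \<in> pts M"
  shows "d_two b X Y Z x = 0"
proof -
  let ?L = "lie_bracket M"
  have sm: "smooth_fun M (\<lambda>y. \<beta> y (W y))" if "W \<in> vector_fields M" for W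
    using \<beta> that by (simp add: real_one_form_def)
  have b: "U x (\<lambda>y. b y (V y) (W y)) = U x (\<lambda>y. V y (\<lambda>z. \<beta> z (W z))) -
      U x (\<lambda>y. W y (\<lambda>z. \<beta> z (V z))) - U x (\<lambda>y. \<beta> y (?L V W y))"
    if U: "U \<in> vector_fields M" and V: "V \<in> vector_fields M" and W: "W \<in> vector_fields M" for U V W
  proof -
    note Ux = vector_field_tangent[OF U x]
    note s1 = vector_field_smooth[OF V sm[OF W]] and s2 = vector_field_smooth[OF W sm[OF V]]
      and s3 = sm[OF lie_bracket_vector_field[OF V W]]
    have "U x (\<lambda>y. b y (V y) (W y)) = U x (\<lambda>y. V y (\<lambda>z. \<beta> z (W z)) -
        W y (\<lambda>z. \<beta> z (V z)) - \<beta> y (?L V W y))"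
      by (rule tangent_cong[OF Ux x, symmetric])
         (simp_all add: smooth_fun_diff s1 s2 s3 d[OF V W] d_one_def)
    then show ?thesis
      by (simp add: tangent_diff[OF Ux] smooth_fun_diff s1 s2 s3)
  qed
  have L: "b x (?L V W x) (U x) = V x (\<lambda>y. W y (\<lambda>z. \<beta> z (U z))) - W x (\<lambda>y. V y (\<lambda>z. \<beta> z (U z)))
      - U x (\<lambda>y. \<beta> y (?L V W y)) - \<beta> x (?L (?L V W) U x)"
    if U: "U \<in> vector_fields M" and V: "V \<in> vector_fields M" and W: "W \<in> vector_fields M" for U V W
    using d[OF lie_bracket_vector_field[OF V W] U x] sm[OF U] by (simp add: d_one_def lie_bracket_def)
  have "\<beta> x (?L (?L X Y) Z x) + \<beta> x (?L (?L Y Z) X x) = \<beta> x (?L (?L X Z) Y x)"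
  proof -
    have "\<beta> x (tv_comb 1 (?L (?L X Y) Z x) 1 (?L (?L Y Z) X x)) =
        1 * \<beta> x (?L (?L X Y) Z x) + 1 * \<beta> x (?L (?L Y Z) X x)"
      using \<beta> x X Y Z unfolding real_one_form_def
      by (blast intro: lie_bracket_vector_field vector_field_tangent)
    then show ?thesis by (simp add: jacobi[OF X Y Z x])
  qed
  then show ?thesis
    by (simp add: d_two_def b[OF X Y Z] b[OF Y X Z] b[OF Z X Y] L[OF Z X Y] L[OF Y X Z] L[OF X Y Z])
qed

end

lemma complexify_1: "complexify \<omega> x [(u, w)] = \<omega> x [u] + \<i> * \<omega> x [w]"
  by (simp add: complexify_def lessThan_Suc Pow_insert)

lemma complexify_2:
  "complexify \<omega> x [(u, w), (u', w')] =
     \<omega> x [u, u'] + \<i> * \<omega> x [w, u'] + \<i> * \<omega> x [u, w'] - \<omega> x [w, w']"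
proof -
  have P: "Pow {..<2::nat} = {{}, {0}, {1}, {0, 1}}"
    by (auto simp: lessThan_Suc eval_nat_numeral Pow_insert)
  have "[0..<2] = [0, 1::nat]" by (simp add: upt_rec)
  moreover have "{0::nat, 1} \<noteq> {0}" "{0::nat, 1} \<noteq> {1}" "{0::nat} \<noteq> {1}" by auto
  ultimately show ?thesis
    by (simp add: complexify_def P numeral_2_eq_2[symmetric] power2_eq_square algebra_simps)
qed


section \<open>Calculus with the Levi-Civita connection\<close>

locale pseudo_kaehler_context = manifold_context M
  for M :: "('a, 'e::euclidean_space) manifold" +
  fixes g :: "'a metric" and J :: "'a endo" and D :: "'a conn"
  assumes metric: "pseudo_riemannian_metric M g"
    and almost_complex: "almost_complex_structure M J"
    and hermitian: "\<And>x u w. x \<in> pts M \<Longrightarrow> u \<in> tangent_space M x \<Longrightarrow> w \<in> tangent_space M x \<Longrightarrow>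
      g x (J x u) (J x w) = g x u w"
    and levi_civita: "levi_civita M g D"
    and parallel: "parallel_endo M D J"
begin

lemma g_sym:
  "x \<in> pts M \<Longrightarrow> u \<in> tangent_space M x \<Longrightarrow> w \<in> tangent_space M x \<Longrightarrow> g x u w = g x w u"
  using metric unfolding pseudo_riemannian_metric_def by blast

lemma g_left:
  "x \<in> pts M \<Longrightarrow> u \<in> tangent_space M x \<Longrightarrow> w \<in> tangent_space M x \<Longrightarrow> z \<in> tangent_space M x \<Longrightarrow>
    g x (tv_comb a u b w) z = a * g x u z + b * g x w z"
  using metric unfolding pseudo_riemannian_metric_def by blast

lemma g_right:
  assumes "x \<in> pts M" "u \<in> tangent_space M x" "w \<in> tangent_space M x" "z \<in> tangent_space M x"
  shows "g x z (tv_comb a u b w) = a * g x z u + b * g x z w"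
  using g_left[OF assms, of a b] g_sym[OF assms(1,4)] assms(2,3) tangent_space_comb[OF assms(2,3), of a b]
  by simp

lemma g_nondegenerate:
  "x \<in> pts M \<Longrightarrow> u \<in> tangent_space M x \<Longrightarrow> (\<And>w. w \<in> tangent_space M x \<Longrightarrow> g x u w = 0) \<Longrightarrow> u = tv_zero"
  using metric unfolding pseudo_riemannian_metric_def by blast

lemma g_smooth:
  "X \<in> vector_fields M \<Longrightarrow> Y \<in> vector_fields M \<Longrightarrow> smooth_fun M (\<lambda>x. g x (X x) (Y x))"
  using metric unfolding pseudo_riemannian_metric_def by blast

lemma J_tangent: "x \<in> pts M \<Longrightarrow> u \<in> tangent_space M x \<Longrightarrow> J x u \<in> tangent_space M x"
  using almost_complex unfolding almost_complex_structure_def by blast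

lemma J_J: "x \<in> pts M \<Longrightarrow> u \<in> tangent_space M x \<Longrightarrow> J x (J x u) = tv_minus u"
  using almost_complex unfolding almost_complex_structure_def by blast

lemma J_comb:
  "x \<in> pts M \<Longrightarrow> u \<in> tangent_space M x \<Longrightarrow> w \<in> tangent_space M x \<Longrightarrow>
    J x (tv_comb a u b w) = tv_comb a (J x u) b (J x w)"
  using almost_complex unfolding almost_complex_structure_def by blast

lemma J_vector_field: "X \<in> vector_fields M \<Longrightarrow> (\<lambda>x. J x (X x)) \<in> vector_fields M"
  using almost_complex unfolding almost_complex_structure_def by blast

lemma g_J:
  assumes "x \<in> pts M" "u \<in> tangent_space M x" "w \<in> tangent_space M x"
  shows "g x (J x u) w = - g x u (J x w)"
proof -
  have "g x (J x u) w = g x (J x (J x u)) (J x w)"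
    using assms by (simp add: hermitian J_tangent)
  also have "\<dots> = - g x u (J x w)"
    using assms by (simp add: J_J tv_minus_conv_comb g_left J_tangent)
  finally show ?thesis .
qed

lemma affine: "affine_connection M D"
  using levi_civita by (simp only: levi_civita_def)

lemma D_tangent:
  "x \<in> pts M \<Longrightarrow> u \<in> tangent_space M x \<Longrightarrow> Y \<in> vector_fields M \<Longrightarrow> D x u Y \<in> tangent_space M x"
  using affine[unfolded affine_connection_def, THEN conjunct1] by blast

lemma D_comb:
  "x \<in> pts M \<Longrightarrow> u \<in> tangent_space M x \<Longrightarrow> w \<in> tangent_space M x \<Longrightarrow> Y \<in> vector_fields M \<Longrightarrow>
    D x (tv_comb a u b w) Y = tv_comb a (D x u Y) b (D x w Y)"
  using affine[unfolded affine_connection_def, THEN conjunct2, THEN conjunct1] by blast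

lemma D_vector_field:
  "X \<in> vector_fields M \<Longrightarrow> Y \<in> vector_fields M \<Longrightarrow> (\<lambda>x. D x (X x) Y) \<in> vector_fields M"
  using affine[unfolded affine_connection_def, THEN conjunct2, THEN conjunct2, THEN conjunct2, THEN conjunct2] by blast

lemma torsion_free:
  "X \<in> vector_fields M \<Longrightarrow> Y \<in> vector_fields M \<Longrightarrow> x \<in> pts M \<Longrightarrow>
    lie_bracket M X Y x = tv_comb 1 (D x (X x) Y) (-1) (D x (Y x) X)"
  using levi_civita[unfolded levi_civita_def, THEN conjunct2, THEN conjunct1] by simp

lemma metric_compatible:
  "x \<in> pts M \<Longrightarrow> u \<in> tangent_space M x \<Longrightarrow> Y \<in> vector_fields M \<Longrightarrow> Z \<in> vector_fields M \<Longrightarrow>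
    u (\<lambda>y. g y (Y y) (Z y)) = g x (D x u Y) (Z x) + g x (Y x) (D x u Z)"
  using levi_civita unfolding levi_civita_def by blast

lemma D_J:
  "x \<in> pts M \<Longrightarrow> u \<in> tangent_space M x \<Longrightarrow> Y \<in> vector_fields M \<Longrightarrow>
    D x u (\<lambda>y. J y (Y y)) = J x (D x u Y)"
  using parallel unfolding parallel_endo_def by blast

lemma real_one_form_metric_dual:
  assumes "V \<in> vector_fields M"
  shows "real_one_form (\<lambda>x u. g x (V x) u)"
  unfolding real_one_form_def
  using assms by (auto simp: g_right vector_field_tangent g_smooth)

lemma d_one_metric_dual:
  assumes V: "V \<in> vector_fields M" and X: "X \<in> vector_fields M" and Y: "Y \<in> vector_fields M"
    and x: "x \<in> pts M"
  shows "d_one (\<lambda>x u. g x (V x) u) X Y x = g x (D x (X x) V) (Y x) - g x (D x (Y x) V) (X x)"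
proof -
  note t = vector_field_tangent[OF V x] vector_field_tangent[OF X x] vector_field_tangent[OF Y x]
  show ?thesis
    by (simp add: d_one_def metric_compatible[OF x] t V X Y torsion_free[OF X Y x] g_right[OF x] D_tangent[OF x])
qed

text \<open>This is \<open>(\<nabla>\<^sub>X b)(Y, Z)\<close>.\<close>

definition cov_deriv ::
  "('a \<Rightarrow> 'a tvec \<Rightarrow> 'a tvec \<Rightarrow> real) \<Rightarrow> 'a vfield \<Rightarrow> 'a vfield \<Rightarrow> 'a vfield \<Rightarrow> 'a \<Rightarrow> real" where
  "cov_deriv b X Y Z x =
     X x (\<lambda>y. b y (Y y) (Z y)) - b x (D x (X x) Y) (Z x) - b x (Y x) (D x (X x) Z)"

text \<open>For a torsion-free connection, \<open>d b\<close> is the cyclic sum of \<open>\<nabla> b\<close>.\<close>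

lemma d_two_cyclic:
  assumes b: "real_two_form b"
    and X: "X \<in> vector_fields M" and Y: "Y \<in> vector_fields M" and Z: "Z \<in> vector_fields M"
    and x: "x \<in> pts M"
  shows "d_two b X Y Z x = cov_deriv b X Y Z x + cov_deriv b Y Z X x + cov_deriv b Z X Y x"
proof -
  note t = vector_field_tangent[OF X x] vector_field_tangent[OF Y x] vector_field_tangent[OF Z x]
  note skew = real_two_form_skew[OF b]
  have "Y x (\<lambda>y. b y (X y) (Z y)) = Y x (\<lambda>y. - b y (Z y) (X y))"
  proof (rule tangent_cong[OF t(2) x real_two_form_smooth[OF b X Z]])
    fix y assume y: "y \<in> pts M"
    show "b y (X y) (Z y) = - b y (Z y) (X y)"
      by (rule skew[OF y X[THEN vector_field_tangent, OF y] Z[THEN vector_field_tangent, OF y]])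
  qed
  also have "\<dots> = - Y x (\<lambda>y. b y (Z y) (X y))"
    by (rule tangent_minus[OF t(2) real_two_form_smooth[OF b Z X]])
  finally have Y': "Y x (\<lambda>y. b y (X y) (Z y)) = - Y x (\<lambda>y. b y (Z y) (X y))" .
  have L: "b x (lie_bracket M V W x) u = b x (D x (V x) W) u - b x (D x (W x) V) u"
    if "V \<in> vector_fields M" "W \<in> vector_fields M" "u \<in> tangent_space M x" for V W u
    using that
    by (simp add: torsion_free[OF _ _ x] real_two_form_left[OF b x] D_tangent[OF x] vector_field_tangent[OF _ x])
  show ?thesis
    unfolding d_two_def cov_deriv_def
    using Y' L[OF X Y t(3)] L[OF X Z t(2)] L[OF Y Z t(1)]
      skew[OF x D_tangent[OF x t(1) Z] t(2)] skew[OF x D_tangent[OF x t(2) X] t(3)]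
      skew[OF x D_tangent[OF x t(3) Y] t(1)]
    by linarith
qed

text \<open>The hypothesis on \<open>J\<close> says that \<open>b\<close> is the real part of a form of type \<open>(2, 0)\<close>, whose imaginary part is
  \<open>- b(J \<cdot>, \<cdot>)\<close>. As \<open>J\<close> is parallel, \<open>N(U, V, W) = (\<nabla>\<^sub>U b)(V, W)\<close> satisfies \<open>N(U, J V, W) = N(U, V, J W)\<close> and
  hence \<open>N(U, J V, J W) = - N(U, V, W)\<close>. The cyclic sums of \<open>N\<close> vanish. Adding those for \<open>(J X, Y, Z)\<close>,
  \<open>(X, J Y, Z)\<close>, \<open>(X, Y, J Z)\<close> and \<open>(J X, J Y, J Z)\<close> leaves twice the cyclic sum of \<open>N(X, J Y, Z)\<close>.\<close>

lemma closed_imp_closed_compose_J: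
  assumes b: "real_two_form b" and b': "real_two_form (\<lambda>x u w. b x (J x u) w)"
    and J: "\<And>x u w. x \<in> pts M \<Longrightarrow> u \<in> tangent_space M x \<Longrightarrow> w \<in> tangent_space M x \<Longrightarrow>
      b x (J x u) w = b x u (J x w)"
    and closed: "\<And>X Y Z x. X \<in> vector_fields M \<Longrightarrow> Y \<in> vector_fields M \<Longrightarrow> Z \<in> vector_fields M \<Longrightarrow>
      x \<in> pts M \<Longrightarrow> d_two b X Y Z x = 0"
    and X: "X \<in> vector_fields M" and Y: "Y \<in> vector_fields M" and Z: "Z \<in> vector_fields M"
    and x: "x \<in> pts M"
  shows "d_two (\<lambda>x u w. b x (J x u) w) X Y Z x = 0"
proof -
  let ?J = "\<lambda>X y. J y (X y)" and ?N = "\<lambda>U V W. cov_deriv b U V W x"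
  note JF = J_vector_field and t = vector_field_tangent[OF _ x]
  have JJ: "b y (J y u) (J y w) = - b y u w"
    if "y \<in> pts M" "u \<in> tangent_space M y" "w \<in> tangent_space M y" for y u w
    using that
    by (simp add: J J_tangent J_J tv_minus_conv_comb real_two_form_right[OF b])
  have shift: "?N U (?J V) W = ?N U V (?J W)"
    if U: "U \<in> vector_fields M" and V: "V \<in> vector_fields M" and W: "W \<in> vector_fields M" for U V W
  proof -
    have "U x (\<lambda>y. b y (J y (V y)) (W y)) = U x (\<lambda>y. b y (V y) (J y (W y)))"
    proof (rule tangent_cong[OF t[OF U] x])
      show "smooth_fun M (\<lambda>y. b y (J y (V y)) (W y))"
        using real_two_form_smooth[OF b' V W] .
    qed (intro J vector_field_tangent V W)
    then show ?thesis
      by (simp add: cov_deriv_def D_J[OF x t[OF U]] V W J[OF x] D_tangent[OF x t[OF U]] t)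
  qed
  have anti: "?N U (?J V) (?J W) = - ?N U V W"
    if U: "U \<in> vector_fields M" and V: "V \<in> vector_fields M" and W: "W \<in> vector_fields M" for U V W
  proof -
    have "U x (\<lambda>y. b y (J y (V y)) (J y (W y))) = U x (\<lambda>y. - b y (V y) (W y))"
    proof (rule tangent_cong[OF t[OF U] x])
      show "smooth_fun M (\<lambda>y. b y (J y (V y)) (J y (W y)))"
        using real_two_form_smooth[OF b JF[OF V] JF[OF W]] .
    qed (intro JJ vector_field_tangent V W)
    then show ?thesis
      by (simp add: cov_deriv_def D_J[OF x t[OF U]] V W JJ[OF x] D_tangent[OF x t[OF U]] t
          tangent_minus[OF t[OF U]] real_two_form_smooth[OF b])
  qed
  have rot: "cov_deriv (\<lambda>x u w. b x (J x u) w) U V W x = ?N U (?J V) W"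
    if "U \<in> vector_fields M" "V \<in> vector_fields M" for U V W
    using that by (simp add: cov_deriv_def D_J[OF x t])
  have cyc: "?N U V W + ?N V W U + ?N W U V = 0"
    if "U \<in> vector_fields M" "V \<in> vector_fields M" "W \<in> vector_fields M" for U V W
    using closed[OF that x] d_two_cyclic[OF b that x] by simp
  have "d_two (\<lambda>x u w. b x (J x u) w) X Y Z x = ?N X (?J Y) Z + ?N Y (?J Z) X + ?N Z (?J X) Y"
    by (simp add: d_two_cyclic[OF b' X Y Z x] rot X Y Z)
  then show ?thesis
    using cyc[OF JF[OF X] Y Z] cyc[OF X JF[OF Y] Z] cyc[OF X Y JF[OF Z]]
      cyc[OF JF[OF X] JF[OF Y] JF[OF Z]]
      shift[OF Y Z X] shift[OF Z X Y] shift[OF X Y Z]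
      anti[OF JF[OF X] Y Z] anti[OF JF[OF Y] Z X] anti[OF JF[OF Z] X Y]
    by linarith
qed


section \<open>Recognising the type of a form\<close>

lemma pq_form_10:
  assumes "real_one_form \<beta>" "real_one_form \<gamma>"
    and "\<And>x u. x \<in> pts M \<Longrightarrow> u \<in> tangent_space M x \<Longrightarrow> \<beta> x (J x u) = - \<gamma> x u"
    and "\<And>x u. x \<in> pts M \<Longrightarrow> u \<in> tangent_space M x \<Longrightarrow> \<gamma> x (J x u) = \<beta> x u"
  shows "pq_form M J 1 0 (one_form \<beta> \<gamma>)"
  unfolding pq_form_def
proof (intro conjI ballI allI impI)
  show "complex_form M (1 + 0) (one_form \<beta> \<gamma>)" using complex_form_one_form[OF assms(1,2)] by simp
  fix x A zs
  assume x: "x \<in> pts M" and A: "A \<subseteq> {..<1 + 0::nat}" and *: "card A \<noteq> 1 \<and> length zs = 1 + 0 \<and>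
    (\<forall>j<1 + 0. zs ! j \<in> (if j \<in> A then T10 M J x else T01 M J x))"
  have "A = {} \<or> A = {0}" using A by auto
  then have "A = {}" using * by auto
  with * obtain u w where zs: "zs = [(u, w)]" "(u, w) \<in> T01 M J x"
    by (auto simp: length_Suc_conv)
  then have "u \<in> tangent_space M x" "w = J x u" by (auto simp: T01_def)
  then show "complexify (one_form \<beta> \<gamma>) x zs = 0"
    by (simp add: zs(1) complexify_1 one_form_def assms(3,4) x complex_eq_iff)
qed

lemma two_form_arguments:
  assumes "length zs = 2" "\<And>j. j < 2 \<Longrightarrow> zs ! j \<in> (if j \<in> A then T10 M J x else T01 M J x)"
  obtains u w u' w' where "zs = [(u, w), (u', w')]"
    "(u, w) \<in> (if 0 \<in> A then T10 M J x else T01 M J x)"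
    "(u', w') \<in> (if 1 \<in> A then T10 M J x else T01 M J x)"
proof -
  obtain z z' where "zs = [z, z']"
    using assms(1) by (auto simp: length_Suc_conv eval_nat_numeral)
  then show ?thesis using that[of "fst z" "snd z" "fst z'" "snd z'"] assms(2)[of 0] assms(2)[of 1] by simp
qed

text \<open>The hypotheses express that \<open>\<Omega> = b + \<i> c\<close> satisfies \<open>\<Omega>(J u, w) = \<i> \<Omega>(u, w)\<close>. Hence \<open>\<Omega>\<close> vanishes when one argument
  is of the form \<open>u + \<i> J u\<close>, that is, in the \<open>- \<i>\<close> eigenspace of \<open>J\<close>.\<close>

lemma pq_form_20:
  assumes b: "real_two_form b" and c: "real_two_form c"
    and bJ: "\<And>x u w. x \<in> pts M \<Longrightarrow> u \<in> tangent_space M x \<Longrightarrow> w \<in> tangent_space M x \<Longrightarrow>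
      b x (J x u) w = - c x u w"
    and cJ: "\<And>x u w. x \<in> pts M \<Longrightarrow> u \<in> tangent_space M x \<Longrightarrow> w \<in> tangent_space M x \<Longrightarrow>
      c x (J x u) w = b x u w"
  shows "pq_form M J 2 0 (two_form b c)"
  unfolding pq_form_def
proof (intro conjI ballI allI impI)
  show "complex_form M (2 + 0) (two_form b c)" using complex_form_two_form[OF b c] by simp
  fix x A zs
  assume x: "x \<in> pts M" and A: "A \<subseteq> {..<2 + 0::nat}" and *: "card A \<noteq> 2 \<and> length zs = 2 + 0 \<and>
    (\<forall>j<2 + 0. zs ! j \<in> (if j \<in> A then T10 M J x else T01 M J x))"
  have "length zs = 2" "\<And>j. j < 2 \<Longrightarrow> zs ! j \<in> (if j \<in> A then T10 M J x else T01 M J x)"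
    using * by auto
  then obtain u w u' w' where zs: "zs = [(u, w), (u', w')]"
    "(u, w) \<in> (if 0 \<in> A then T10 M J x else T01 M J x)"
    "(u', w') \<in> (if 1 \<in> A then T10 M J x else T01 M J x)"
    by (rule two_form_arguments)
  have t: "u \<in> tangent_space M x" "w \<in> tangent_space M x" "u' \<in> tangent_space M x" "w' \<in> tangent_space M x"
    using zs(2,3) by (auto simp: T10_def T01_def split: if_splits)
  have right: "b x z (J x z') = - c x z z'" "c x z (J x z') = b x z z'"
    if "z \<in> tangent_space M x" "z' \<in> tangent_space M x" for z z'
    using that bJ[OF x that(2,1)] cJ[OF x that(2,1)]
      real_two_form_skew[OF b x that(1) J_tangent[OF x that(2)]] real_two_form_skew[OF b x that]
      real_two_form_skew[OF c x that(1) J_tangent[OF x that(2)]] real_two_form_skew[OF c x that]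
    by linarith+
  have "A \<noteq> {0, 1}" using * by auto
  then have "0 \<notin> A \<or> 1 \<notin> A" using A by (auto simp: less_2_cases_iff subset_iff)
  then consider "w = J x u" | "w' = J x u'"
    using zs(2,3) by (auto simp: T01_def)
  then show "complexify (two_form b c) x zs = 0"
    by cases (simp_all add: zs(1) complexify_2 two_form_def complex_eq_iff bJ[OF x] cJ[OF x] right t)
qed

text \<open>A \<open>J\<close>-invariant form \<open>\<Omega>\<close> vanishes on two vectors from the same eigenspace, because
  \<open>\<Omega>(z, z') = \<Omega>(J z, J z') = \<lambda>\<^sup>2 \<Omega>(z, z')\<close> with \<open>\<lambda>\<^sup>2 = -1\<close>.\<close>

lemma pq_form_11:
  assumes b: "real_two_form b" and c: "real_two_form c"
    and bJ: "\<And>x u w. x \<in> pts M \<Longrightarrow> u \<in> tangent_space M x \<Longrightarrow> w \<in> tangent_space M x \<Longrightarrow>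
      b x (J x u) (J x w) = b x u w"
    and cJ: "\<And>x u w. x \<in> pts M \<Longrightarrow> u \<in> tangent_space M x \<Longrightarrow> w \<in> tangent_space M x \<Longrightarrow>
      c x (J x u) (J x w) = c x u w"
  shows "pq_form M J 1 1 (two_form b c)"
  unfolding pq_form_def
proof (intro conjI ballI allI impI)
  show "complex_form M (1 + 1) (two_form b c)"
    using complex_form_two_form[OF b c] by (simp only: one_add_one)
  fix x A zs
  assume x: "x \<in> pts M" and A: "A \<subseteq> {..<1 + 1::nat}" and *: "card A \<noteq> 1 \<and> length zs = 1 + 1 \<and>
    (\<forall>j<1 + 1. zs ! j \<in> (if j \<in> A then T10 M J x else T01 M J x))"
  have "length zs = 2" "\<And>j. j < 2 \<Longrightarrow> zs ! j \<in> (if j \<in> A then T10 M J x else T01 M J x)"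
    using * by auto
  then obtain u w u' w' where zs: "zs = [(u, w), (u', w')]"
    "(u, w) \<in> (if 0 \<in> A then T10 M J x else T01 M J x)"
    "(u', w') \<in> (if 1 \<in> A then T10 M J x else T01 M J x)"
    by (rule two_form_arguments)
  have t: "u \<in> tangent_space M x" "w \<in> tangent_space M x" "u' \<in> tangent_space M x" "w' \<in> tangent_space M x"
    using zs(2,3) by (auto simp: T10_def T01_def split: if_splits)
  have shift: "b x z (J x z') = - b x (J x z) z'" "c x z (J x z') = - c x (J x z) z'"
    if z: "z \<in> tangent_space M x" "z' \<in> tangent_space M x" for z z'
    using bJ[OF x z(1) J_tangent[OF x z(2)]] cJ[OF x z(1) J_tangent[OF x z(2)]]
    by (simp_all add: J_J x z tv_minus_conv_comb real_two_form_right[OF b x]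
        real_two_form_right[OF c x] J_tangent)
  have "{..<1 + 1} = {0, 1::nat}" by auto
  with A have "A \<subseteq> {0, 1}" by simp
  then have "0 \<in> A \<and> 1 \<notin> A \<longrightarrow> A = {0}" "1 \<in> A \<and> 0 \<notin> A \<longrightarrow> A = {1}" by blast+
  then have "0 \<in> A \<longleftrightarrow> 1 \<in> A" using * by auto
  then consider "w = J x u" "w' = J x u'" | "u = J x w" "u' = J x w'"
    using zs(2,3) by (auto simp: T01_def T10_def split: if_splits)
  then show "complexify (two_form b c) x zs = 0"
  proof cases
    case 1
    then show ?thesis
      using bJ[OF x t(1,3)] cJ[OF x t(1,3)] shift[OF t(1,3)]
      by (simp add: zs(1) complexify_2 two_form_def complex_eq_iff)
  next
    case 2
    then show ?thesis
      using bJ[OF x t(2,4)] cJ[OF x t(2,4)] shift[OF t(2,4)]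
      by (simp add: zs(1) complexify_2 two_form_def complex_eq_iff)
  qed
qed

end

section \<open>The Lie derivative of the Kaehler form along a Killing field\<close>

locale killing_context = pseudo_kaehler_context M g J D
  for M :: "('a, 'e::euclidean_space) manifold" and g J D +
  fixes v :: "'a vfield"
  assumes killing: "killing_field M g v"
begin

lemma v: "v \<in> vector_fields M"
  using killing by (simp add: killing_field_def)

definition nabla :: "'a \<Rightarrow> 'a tvec \<Rightarrow> 'a tvec \<Rightarrow> real" where
  "nabla x u w = g x (D x u v) w"

text \<open>Skewness is the Killing equation. It is first obtained for vector fields, and therefore for
  tangent vectors by extending them.\<close>

lemma nabla_two_form: "real_two_form nabla"
  unfolding real_two_form_def
proof (intro conjI ballI allI)
  show "nabla x (tv_comb a u c w) z = a * nabla x u z + c * nabla x w z"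
    if "x \<in> pts M" "u \<in> tangent_space M x" "w \<in> tangent_space M x" "z \<in> tangent_space M x" for x u w z a c
    using that by (simp add: nabla_def D_comb v g_left D_tangent)
  show "smooth_fun M (\<lambda>x. nabla x (X x) (Y x))" if "X \<in> vector_fields M" "Y \<in> vector_fields M" for X Y
    unfolding nabla_def by (intro g_smooth D_vector_field v that)
  fix x u w assume x: "x \<in> pts M" and u: "u \<in> tangent_space M x" and w: "w \<in> tangent_space M x"
  obtain X where X: "X \<in> vector_fields M" "X x = u" using tangent_extends_to_vector_field[OF x u] .
  obtain Y where Y: "Y \<in> vector_fields M" "Y x = w" using tangent_extends_to_vector_field[OF x w] .
  note vx = vector_field_tangent[OF v x]
  have "lie_deriv_metric M v g X Y x = 0"
    using killing x X Y by (simp add: killing_field_def)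
  moreover have "v x (\<lambda>y. g y (X y) (Y y)) = g x (D x (v x) X) w + g x u (D x (v x) Y)"
    using metric_compatible[OF x vx X(1) Y(1)] X Y by simp
  moreover have "g x (lie_bracket M v X x) w = g x (D x (v x) X) w - g x (D x u v) w"
    using torsion_free[OF v X(1) x] by (simp add: g_left x D_tangent vx X u w v)
  moreover have "g x u (lie_bracket M v Y x) = g x u (D x (v x) Y) - g x u (D x w v)"
    using torsion_free[OF v Y(1) x] by (simp add: g_right x D_tangent vx Y u w v)
  ultimately have "g x (D x u v) w + g x u (D x w v) = 0"
    by (simp add: lie_deriv_metric_def X Y)
  then show "nabla x u w = - nabla x w u"
    using g_sym[OF x u D_tangent[OF x w v]] by (simp add: nabla_def)
qed

text \<open>The Lie derivative \<open>L\<^sub>v \<omega>\<close> of the Kaehler form \<open>\<omega> = g(J \<cdot>, \<cdot>)\<close>, expressed by \<open>\<nabla> v\<close>.\<close>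

definition lie_omega :: "'a \<Rightarrow> 'a tvec \<Rightarrow> 'a tvec \<Rightarrow> real" where
  "lie_omega x u w = - nabla x u (J x w) - nabla x (J x u) w"

lemma nabla_J_J_two_form: "real_two_form (\<lambda>x u w. nabla x (J x u) (J x w))"
  unfolding real_two_form_def
proof (intro conjI ballI allI)
  show "smooth_fun M (\<lambda>x. nabla x (J x (X x)) (J x (Y x)))"
    if "X \<in> vector_fields M" "Y \<in> vector_fields M" for X Y
    using real_two_form_smooth[OF nabla_two_form J_vector_field[OF that(1)] J_vector_field[OF that(2)]] .
  fix x u w assume *: "x \<in> pts M" "u \<in> tangent_space M x" "w \<in> tangent_space M x"
  show "nabla x (J x u) (J x w) = - nabla x (J x w) (J x u)"
    using real_two_form_skew[OF nabla_two_form *(1) J_tangent[OF *(1,2)] J_tangent[OF *(1,3)]] .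
  show "nabla x (J x (tv_comb a u c w)) (J x z) = a * nabla x (J x u) (J x z) + c * nabla x (J x w) (J x z)"
    if "z \<in> tangent_space M x" for z a c
    using * that by (simp add: J_comb real_two_form_left[OF nabla_two_form] J_tangent)
qed

lemma lie_omega_two_form: "real_two_form lie_omega"
  unfolding real_two_form_def
proof (intro conjI ballI allI)
  note c = nabla_two_form
  show "smooth_fun M (\<lambda>x. lie_omega x (X x) (Y x))"
    if "X \<in> vector_fields M" "Y \<in> vector_fields M" for X Y
    unfolding lie_omega_def
    using real_two_form_smooth[OF c that(1) J_vector_field[OF that(2)]]
      real_two_form_smooth[OF c J_vector_field[OF that(1)] that(2)]
    by (intro smooth_fun_diff smooth_fun_minus)
  fix x u w assume *: "x \<in> pts M" "u \<in> tangent_space M x" "w \<in> tangent_space M x"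
  show "lie_omega x u w = - lie_omega x w u"
    using real_two_form_skew[OF c *(1,2) J_tangent[OF *(1,3)]]
      real_two_form_skew[OF c *(1) J_tangent[OF *(1,2)] *(3)]
    by (simp add: lie_omega_def)
  show "lie_omega x (tv_comb p u q w) z = p * lie_omega x u z + q * lie_omega x w z"
    if "z \<in> tangent_space M x" for z p q
    using * that
    by (simp add: lie_omega_def J_comb real_two_form_left[OF c] J_tangent algebra_simps)
qed

text \<open>Equality of the two right-hand sides says that \<open>L\<^sub>v \<omega>\<close> is of type \<open>(2, 0) + (0, 2)\<close>.\<close>

lemma lie_omega_J:
  assumes x: "x \<in> pts M" and u: "u \<in> tangent_space M x" and w: "w \<in> tangent_space M x"
  shows "lie_omega x (J x u) w = nabla x u w - nabla x (J x u) (J x w)"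
    and "lie_omega x u (J x w) = nabla x u w - nabla x (J x u) (J x w)"
  using assms
  by (simp_all add: lie_omega_def J_J tv_minus_conv_comb real_two_form_left[OF nabla_two_form x]
      real_two_form_right[OF nabla_two_form x] J_tangent)

lemma lie_omega_J_two_form: "real_two_form (\<lambda>x u w. lie_omega x (J x u) w)"
  unfolding real_two_form_def
proof (intro conjI ballI allI)
  note c = lie_omega_two_form
  show "smooth_fun M (\<lambda>x. lie_omega x (J x (X x)) (Y x))"
    if "X \<in> vector_fields M" "Y \<in> vector_fields M" for X Y
    using real_two_form_smooth[OF c J_vector_field[OF that(1)] that(2)] .
  fix x u w assume *: "x \<in> pts M" "u \<in> tangent_space M x" "w \<in> tangent_space M x"
  show "lie_omega x (J x u) w = - lie_omega x (J x w) u"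
    using real_two_form_skew[OF c *(1) J_tangent[OF *(1,2)] *(3)] lie_omega_J[OF *(1,3,2)] by simp
  show "lie_omega x (J x (tv_comb p u q w)) z = p * lie_omega x (J x u) z + q * lie_omega x (J x w) z"
    if "z \<in> tangent_space M x" for z p q
    using * that by (simp add: J_comb real_two_form_left[OF c] J_tangent)
qed

text \<open>The first equation is Cartan's formula \<open>L\<^sub>v \<omega> = d (\<omega>(v, \<cdot>))\<close> for the closed form \<open>\<omega>\<close>; here closedness is
  contained in the facts that \<open>J\<close> is parallel and \<open>\<nabla>\<close> torsion-free.\<close>

lemma d_contraction:
  assumes "X \<in> vector_fields M" "Y \<in> vector_fields M" "x \<in> pts M"
  shows "d_one (\<lambda>x u. g x (J x (v x)) u) X Y x = lie_omega x (X x) (Y x)"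
    and "d_one (\<lambda>x u. g x (v x) u) X Y x = 2 * nabla x (X x) (Y x)"
proof -
  note t = assms(1,2)[THEN vector_field_tangent, OF assms(3)]
  note skew = real_two_form_skew[OF nabla_two_form assms(3)]
  show "d_one (\<lambda>x u. g x (J x (v x)) u) X Y x = lie_omega x (X x) (Y x)"
    using d_one_metric_dual[OF J_vector_field[OF v] assms] skew[OF J_tangent[OF assms(3) t(1)] t(2)]
    by (simp add: D_J g_J D_tangent assms t v lie_omega_def nabla_def)
  show "d_one (\<lambda>x u. g x (v x) u) X Y x = 2 * nabla x (X x) (Y x)"
    using d_one_metric_dual[OF v assms] skew[OF t] by (simp add: nabla_def)
qed

lemma lie_omega_closed:
  assumes "X \<in> vector_fields M" "Y \<in> vector_fields M" "Z \<in> vector_fields M" "x \<in> pts M"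
  shows "d_two lie_omega X Y Z x = 0"
  by (rule d_two_d_one[OF real_one_form_metric_dual[OF J_vector_field[OF v]] _ assms])
     (simp add: d_contraction)

text \<open>The \<open>(2, 0)\<close> part of \<open>L\<^sub>v \<omega>\<close>.\<close>

definition sigma20 :: "'a cform" where
  "sigma20 = two_form (\<lambda>x u w. 1/2 * lie_omega x u w) (\<lambda>x u w. - 1/2 * lie_omega x (J x u) w)"

text \<open>The \<open>(1, 1)\<close> part of \<open>d\<close> applied to the \<open>(1, 0)\<close> part of \<open>\<omega>(v, \<cdot>)\<close>. It is purely imaginary; the factor
  \<open>0\<close> makes the real part visibly a two-form.\<close>

definition theta11 :: "'a cform" where
  "theta11 = two_form (\<lambda>x u w. 0 * nabla x u w) (\<lambda>x u w. - 1/2 * nabla x u w + - 1/2 * nabla x (J x u) (J x w))"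

text \<open>The \<open>(1, 0)\<close> part of \<open>\<beta> = \<omega>(v, \<cdot>)\<close>, namely \<open>(\<beta>(u) - \<i> \<beta>(J u)) / 2\<close> with \<open>\<beta>(J u) = g(v, u)\<close>.\<close>

definition beta10 :: "'a cform" where
  "beta10 = one_form (\<lambda>x u. 1/2 * g x (J x (v x)) u) (\<lambda>x u. - 1/2 * g x (v x) u)"

text \<open>By \<open>d_contraction\<close>, the derivative of \<open>beta10\<close> is \<open>\<alpha> / 2 - \<i> a\<close> with \<open>\<alpha> = lie_omega\<close> and \<open>a = nabla\<close>; subtracting
  \<open>sigma20\<close> leaves a \<open>J\<close>-invariant form. That no \<open>(0, 2)\<close> part occurs reflects the integrability of \<open>J\<close>.\<close>

lemma dolbeault_beta10: "dolbeault M J 1 0 beta10 sigma20 theta11"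
  unfolding dolbeault_def
proof (intro conjI)
  have b1: "real_one_form (\<lambda>x u. 1/2 * g x (J x (v x)) u)" and b2: "real_one_form (\<lambda>x u. - 1/2 * g x (v x) u)"
    by (intro real_one_form_scale real_one_form_metric_dual v J_vector_field[OF v])+
  show "pq_form M J 1 0 beta10"
    unfolding beta10_def
  proof (rule pq_form_10[OF b1 b2])
    fix x u assume *: "x \<in> pts M" "u \<in> tangent_space M x"
    show "1/2 * g x (J x (v x)) (J x u) = - (- 1/2 * g x (v x) u)"
      using hermitian[OF *(1) vector_field_tangent[OF v *(1)] *(2)] by simp
    show "- 1/2 * g x (v x) (J x u) = 1/2 * g x (J x (v x)) u"
      using g_J[OF *(1) vector_field_tangent[OF v *(1)] *(2)] by simp
  qed
  have "pq_form M J 2 0 sigma20"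
    unfolding sigma20_def
  proof (rule pq_form_20[OF real_two_form_scale[OF lie_omega_two_form]
        real_two_form_scale[OF lie_omega_J_two_form]])
    fix x u w assume *: "x \<in> pts M" "u \<in> tangent_space M x" "w \<in> tangent_space M x"
    then show "- 1/2 * lie_omega x (J x (J x u)) w = 1/2 * lie_omega x u w"
      by (simp add: J_J tv_minus_conv_comb real_two_form_left[OF lie_omega_two_form])
  qed simp
  then show "pq_form M J (Suc 1) 0 sigma20" by (simp add: numeral_2_eq_2)
  have "pq_form M J 1 1 theta11"
    unfolding theta11_def
  proof (rule pq_form_11[OF real_two_form_scale[OF nabla_two_form]
        real_two_form_comb[OF nabla_two_form nabla_J_J_two_form]])
    fix x u w assume *: "x \<in> pts M" "u \<in> tangent_space M x" "w \<in> tangent_space M x"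
    show "- 1/2 * nabla x (J x u) (J x w) + - 1/2 * nabla x (J x (J x u)) (J x (J x w)) =
        - 1/2 * nabla x u w + - 1/2 * nabla x (J x u) (J x w)"
      using * by (simp add: J_J tv_minus_conv_comb real_two_form_left[OF nabla_two_form]
          real_two_form_right[OF nabla_two_form] J_tangent tangent_space_comb)
  qed simp
  then show "pq_form M J 1 (Suc 0) theta11" by simp
  show "has_ext_deriv M (1 + 0) beta10 (\<lambda>x us. sigma20 x us + theta11 x us)"
    unfolding has_ext_deriv_def
  proof (intro conjI allI impI ballI)
    show "complex_form M (1 + 0) beta10"
      using complex_form_one_form[OF b1 b2] by (simp add: beta10_def)
    \<comment> \<open>The factor \<open>1\<close> brings the sum into the shape of \<open>real_two_form_comb\<close>.\<close>
    let ?c = "\<lambda>x u w. - 1/2 * lie_omega x (J x u) w +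
      1 * (- 1/2 * nabla x u w + - 1/2 * nabla x (J x u) (J x w))"
    have "(\<lambda>x us. sigma20 x us + theta11 x us) = two_form (\<lambda>x u w. 1/2 * lie_omega x u w) ?c"
      by (intro ext) (simp add: sigma20_def theta11_def two_form_def complex_eq_iff)
    moreover have "complex_form M 2 (two_form (\<lambda>x u w. 1/2 * lie_omega x u w) ?c)"
      by (intro complex_form_two_form real_two_form_scale real_two_form_comb lie_omega_two_form
          lie_omega_J_two_form nabla_two_form nabla_J_J_two_form)
    ultimately show "complex_form M (Suc (1 + 0)) (\<lambda>x us. sigma20 x us + theta11 x us)"
      by (simp add: numeral_2_eq_2)
    fix Xs x assume Xs: "length Xs = Suc (1 + 0) \<and> set Xs \<subseteq> vector_fields M" and x: "x \<in> pts M"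
    from Xs obtain X Y where XY: "Xs = [X, Y]" "X \<in> vector_fields M" "Y \<in> vector_fields M"
      by (auto simp: length_Suc_conv)
    note t = XY(2,3)[THEN vector_field_tangent, OF x]
    have "ext_deriv_formula M beta10 Xs x =
        Complex (1/2 * lie_omega x (X x) (Y x)) (- 1/2 * (2 * nabla x (X x) (Y x)))"
      unfolding beta10_def XY(1) ext_deriv_formula_one_form
      by (simp only: d_one_scale[OF real_one_form_metric_dual[OF J_vector_field[OF v]] XY(2,3) x]
          d_one_scale[OF real_one_form_metric_dual[OF v] XY(2,3) x] d_contraction[OF XY(2,3) x])
    then show "sigma20 x (map (\<lambda>X. X x) Xs) + theta11 x (map (\<lambda>X. X x) Xs) = ext_deriv_formula M beta10 Xs x"
      by (simp add: XY(1) sigma20_def theta11_def two_form_def complex_eq_iff lie_omega_J[OF x t] field_simps)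
  qed
qed

lemma closed_sigma20: "closed_form M 2 sigma20"
  unfolding closed_form_def has_ext_deriv_def
proof (intro conjI allI impI ballI)
  show "complex_form M 2 sigma20"
    unfolding sigma20_def
    by (intro complex_form_two_form real_two_form_scale lie_omega_two_form lie_omega_J_two_form)
  show "complex_form M (Suc 2) (\<lambda>x us. 0)"
    by (simp add: complex_form_def smooth_fun_const)
  fix Xs x assume Xs: "length Xs = Suc 2 \<and> set Xs \<subseteq> vector_fields M" and x: "x \<in> pts M"
  then obtain X Y Z where XYZ: "Xs = [X, Y, Z]" "X \<in> vector_fields M" "Y \<in> vector_fields M" "Z \<in> vector_fields M"
    by (auto simp: length_Suc_conv eval_nat_numeral)
  have "d_two (\<lambda>x u w. lie_omega x (J x u) w) X Y Z x = 0"
    by (rule closed_imp_closed_compose_J[OF lie_omega_two_form lie_omega_J_two_form _ lie_omega_closed XYZ(2-4) x])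
       (simp_all add: lie_omega_J)
  then show "0 = ext_deriv_formula M sigma20 Xs x"
    unfolding sigma20_def XYZ(1) ext_deriv_formula_two_form
    using lie_omega_closed[OF XYZ(2-4) x]
    by (simp only: d_two_scale[OF lie_omega_two_form XYZ(2-4) x]
        d_two_scale[OF lie_omega_J_two_form XYZ(2-4) x]) (simp add: complex_eq_iff)
qed

text \<open>The \<open>\<partial>\<close>-\<open>\<partial>\<close>-bar property gives \<open>sigma20 = 0\<close>. Its real part is half of \<open>g(J \<nabla>\<^sub>u v - \<nabla>\<^bsub>J u\<^esub> v, w)\<close>, so
  nondegeneracy of \<open>g\<close> applies.\<close>

lemma nabla_v_J_linear:
  assumes "deldelbar_property M J" and x: "x \<in> pts M" and u: "u \<in> tangent_space M x"
  shows "D x (J x u) v = J x (D x u v)"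
proof -
  have pq: "pq_form M J 2 0 sigma20"
    using dolbeault_beta10 by (simp add: dolbeault_def numeral_2_eq_2)
  have "del_exact M J 2 0 sigma20"
    using dolbeault_beta10 by (auto simp: del_exact_def numeral_2_eq_2)
  then have "deldelbar_exact M J 2 0 sigma20"
    using assms(1) pq closed_sigma20 unfolding deldelbar_property_def by (metis add_0_right)
  then have zero: "form_zero M 2 sigma20" by (simp add: deldelbar_exact_def)
  have "tv_comb 1 (D x (J x u) v) (-1) (J x (D x u v)) = tv_zero"
  proof (rule g_nondegenerate[OF x])
    show "tv_comb 1 (D x (J x u) v) (-1) (J x (D x u v)) \<in> tangent_space M x"
      by (intro tangent_space_comb D_tangent J_tangent x u v)
    fix w assume w: "w \<in> tangent_space M x"
    have "sigma20 x [u, w] = 0" using zero x u w by (simp add: form_zero_def)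
    then have "lie_omega x u w = 0" by (simp add: sigma20_def two_form_def complex_eq_iff)
    then show "g x (tv_comb 1 (D x (J x u) v) (-1) (J x (D x u v))) w = 0"
      by (simp add: g_left g_J lie_omega_def nabla_def D_tangent J_tangent x u v w)
  qed
  then show ?thesis
    by (auto simp: tv_comb_def tv_zero_def fun_eq_iff)
qed

text \<open>As \<open>\<nabla>\<close> is torsion-free and \<open>J\<close> parallel, \<open>(L\<^sub>v J) X = J \<nabla>\<^sub>X v - \<nabla>\<^bsub>J X\<^esub> v\<close>.\<close>

lemma killing_real_holomorphic:
  assumes "deldelbar_property M J"
  shows "real_holomorphic M J v"
  unfolding real_holomorphic_def
proof (intro conjI ballI v)
  fix X x assume X: "X \<in> vector_fields M" and x: "x \<in> pts M"
  note vx = vector_field_tangent[OF v x] and Xx = vector_field_tangent[OF X x]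
  have "lie_bracket M v (\<lambda>y. J y (X y)) x = tv_comb 1 (J x (D x (v x) X)) (-1) (J x (D x (X x) v))"
    by (simp add: torsion_free[OF v J_vector_field[OF X] x] D_J[OF x vx X] nabla_v_J_linear[OF assms x Xx])
  moreover have "J x (lie_bracket M v X x) = tv_comb 1 (J x (D x (v x) X)) (-1) (J x (D x (X x) v))"
    by (simp add: torsion_free[OF v X x] J_comb x D_tangent vx Xx v X)
  ultimately show "lie_deriv_endo M v J X x = tv_zero"
    by (simp add: lie_deriv_endo_def tv_comb_def tv_zero_def)
qed

end

theorem theoremA:
  fixes M :: "('a, 'e::euclidean_space) manifold"
    and g :: "'a metric" and J :: "'a endo" and v :: "'a vfield"
  assumes "pseudo_kaehler M g J"
    and "compact_space (mtop M)"
    and "deldelbar_property M J"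
    and "killing_field M g v"
  shows "real_holomorphic M J v"
proof -
  obtain D where D: "levi_civita M g D" "parallel_endo M D J"
    using assms(1) by (auto simp: pseudo_kaehler_def)
  interpret killing_context M g J D v
    by unfold_locales (use assms(1,4) D in \<open>simp_all add: pseudo_kaehler_def\<close>)
  show ?thesis by (rule killing_real_holomorphic[OF assms(3)])
qed

end
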